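(* Let $P \subset \mathbb{R}^d$ be a $d$-dimensional simple rational polytope with vertex set $V$, and for $t>0$ let $L_P(t) := |tP \cap \mathbb{Z}^d|$. (a) For almost all $z \in \mathbb{C}^d$ and all real $t>0$, $$L_P(t) = \frac{(-1)^d}{d!} \sum_{v \in V} \sum_{k=0}^d \binom{d}{k} B_k\big(t\langle v, z\rangle, \mathbf{a}_v\big) \sum_{p \in (\mathbb{Z}^d - tv)\cap \Pi_v} \langle p, z\rangle^{d-k}.$$ (b) Writing $L_P(t) = \sum_{r=0}^d c_r(t)\, t^r$ with (quasi-)coefficients $c_r(t)$, for almost all $z \in \mathbb{C}^d$ and all $t>0$, $$c_r(t) = \frac{(-1)^d}{d!} \sum_{v \in V} \langle v, z\rangle^r \sum_{j=0}^{d-r} \binom{d}{r,j} B_j(\mathbf{a}_v) \sum_{p \in (\mathbb{Z}^d - tv)\cap\Pi_v} \langle p, z\rangle^{d-r-j}.$$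
   Context: A polytope is simple if each vertex lies on exactly $d$ edges. For each vertex $v$ of $P$, let $w_1(v),\dots,w_d(v)$ be the primitive integer vectors (integer vectors whose coordinates have gcd $1$) pointing along the $d$ edges emanating from $v$. The half-open fundamental parallelepiped is $\Pi_v := \{\sum_{k=1}^d \lambda_k w_k(v) : 0 \le \lambda_k < 1\}$. For $x \in \mathbb{R}^d$ (or $\mathbb{C}^d$) and $z \in \mathbb{C}^d$, $\langle x, z\rangle := \sum_{m=1}^d x_m z_m$ (no complex conjugation). Set $\mathbf{a}_v := (\langle w_1(v), z\rangle, \dots, \langle w_d(v), z\rangle) \in \mathbb{C}^d$. For $\mathbf{a}=(a_1,\dots,a_d)\in\mathbb{C}^d$ with all $a_j \neq 0$, the Barnes polynomials $B_k(t,\mathbf{a})$ are defined by the expansion near $x=0$ $$\frac{x^d e^{tx}}{(e^{a_1x}-1)\cdots(e^{a_dx}-1)} = \sum_{k\ge 0} B_k(t,\mathbf{a})\frac{x^k}{k!},$$ and the Barnes numbers are $B_k(\mathbf{a}) := B_k(0,\mathbf{a})$. The sum over $p \in (\mathbb{Z}^d - tv)\cap\Pi_v$ runs over the finitely many points of the translated lattice $\mathbb{Z}^d - tv$ lying in $\Pi_v$ (equivalently, $p = q - tv$ with $q \in (\Pi_v + tv)\cap \mathbb{Z}^d$); we use $\langle p,z\rangle^0 = 1$. The multinomial coefficient is $\binom{n}{r,j} := \frac{n!}{r!\,j!\,(n-r-j)!}$. "For almost all $z\in\mathbb{C}^d$" means for all $z$ with $\langle z, w_k(v)\rangle \notin 2\pi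 i \mathbb{Z}$ for every vertex $v$ and every $k$. *)

theory Defs
  imports "HOL-Analysis.Analysis"
begin

definition vertices :: "(real ^ 'n) set \<Rightarrow> (real ^ 'n) set" where
  "vertices P = {v. v extreme_point_of P}"

definition rational_polytope :: "(real ^ 'n) set \<Rightarrow> bool" where
  "rational_polytope P \<longleftrightarrow> polytope P \<and> (\<forall>v \<in> vertices P. \<forall>i. v $ i \<in> \<rat>)"

text \<open>Only used for polytopes of full dimension \<open>CARD('n)\<close>.\<close>

definition simple_polytope :: "(real ^ 'n) set \<Rightarrow> bool" where
  "simple_polytope P \<longleftrightarrow>
     polytope P \<and> (\<forall>v \<in> vertices P. card {e. e edge_of P \<and> v \<in> e} = CARD('n))"

definition int_lattice :: "(real ^ 'n) set" where
  "int_lattice = {x. \<forall>i. x $ i \<in> \<int>}"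

definition lattice_count :: "(real ^ 'n) set \<Rightarrow> real \<Rightarrow> nat" where
  "lattice_count P t = card ((*\<^sub>R) t ` P \<inter> int_lattice)"

definition primitive_vector :: "real ^ 'n \<Rightarrow> bool" where
  "primitive_vector w \<longleftrightarrow>
     (\<exists>u :: int ^ 'n. w = (\<chi> i. real_of_int (u $ i)) \<and> (GCD i. u $ i) = 1)"

definition primitive_edge_vectors :: "(real ^ 'n) set \<Rightarrow> real ^ 'n \<Rightarrow> (real ^ 'n) set" where
  "primitive_edge_vectors P v =
     {w. primitive_vector w \<and> (\<exists>e. e edge_of P \<and> v \<in> e \<and> (\<exists>s>0. v + s *\<^sub>R w \<in> e))}"

definition half_open_pped :: "('n \<Rightarrow> real ^ 'n) \<Rightarrow> (real ^ 'n) set" where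
  "half_open_pped w = {\<Sum>k\<in>UNIV. c k *\<^sub>R w k |c. \<forall>k. 0 \<le> c k \<and> c k < 1}"

text \<open>The bilinear pairing of a real with a complex vector; there is no complex conjugation,
  so this is not the Hermitian inner product.\<close>

definition pairing :: "real ^ 'n \<Rightarrow> complex ^ 'n \<Rightarrow> complex" where
  "pairing x z = (\<Sum>m\<in>UNIV. complex_of_real (x $ m) * z $ m)"

text \<open>The generating function as a formal power series. The denominator has subdegree
  \<open>CARD('n)\<close> when all \<open>a $ j\<close> are nonzero, so the division is then exact;
  \<open>barnes_poly_sums\<close> below is the corresponding expansion of functions.\<close>

definition barnes_fps :: "complex \<Rightarrow> complex ^ 'n \<Rightarrow> complex fps" where
  "barnes_fps t a =
     (fps_X ^ CARD('n) * fps_exp t) / (\<Prod>j\<in>UNIV. fps_exp (a $ j) - 1)"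

definition barnes_poly :: "nat \<Rightarrow> complex \<Rightarrow> complex ^ 'n \<Rightarrow> complex" where
  "barnes_poly k t a = fact k * fps_nth (barnes_fps t a) k"

definition barnes_number :: "nat \<Rightarrow> complex ^ 'n \<Rightarrow> complex" where
  "barnes_number k a = barnes_poly k 0 a"

lemma barnes_poly_sums:
  fixes a :: "complex ^ 'n" and t :: complex
  assumes "\<And>j. a $ j \<noteq> 0"
  shows "eventually (\<lambda>x. (\<lambda>k. barnes_poly k t a * x ^ k / fact k) sums
           (x ^ CARD('n) * exp (t * x) / (\<Prod>j\<in>UNIV. exp (a $ j * x) - 1))) (at 0)"
proof -
  let ?F = "fps_X ^ CARD('n) * fps_exp t"
  let ?G = "\<Prod>j\<in>UNIV. fps_exp (a $ j) - 1"
  let ?g = "\<lambda>x. \<Prod>j\<in>UNIV. exp (a $ j * x) - 1"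
  have sub1: "subdegree (fps_exp (a $ j) - 1) = 1" for j
    by (rule subdegreeI) (use assms[of j] in auto)
  have nz1: "fps_exp (a $ j) - 1 \<noteq> 0" for j
    using sub1[of j] by (metis subdegree_0 zero_neq_one)
  have G: "?G \<noteq> 0"
    using nz1 by simp
  have subG: "subdegree ?G = CARD('n)"
    by (subst subdegree_prod) (simp_all only: nz1 sub1 sum_constant of_nat_id mult_1_right not_False_eq_True)
  have subF: "subdegree ?F = CARD('n)"
    by simp
  have "(\<lambda>x. if x = 0 then fps_nth ?F (subdegree ?G) / fps_nth ?G (subdegree ?G)
             else x ^ CARD('n) * exp (t * x) / ?g x) has_fps_expansion ?F / ?G"
    by (rule has_fps_expansion_divide) (auto intro!: fps_expansion_intros simp: subG subF G nz1)
  then have r: "fps_conv_radius (barnes_fps t a) > 0"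
    and e: "eventually (\<lambda>x. eval_fps (barnes_fps t a) x =
      (if x = 0 then fps_nth ?F (subdegree ?G) / fps_nth ?G (subdegree ?G)
       else x ^ CARD('n) * exp (t * x) / ?g x)) (nhds 0)"
    by (auto simp: has_fps_expansion_def barnes_fps_def)
  have "eventually (\<lambda>x. x \<in> eball 0 (fps_conv_radius (barnes_fps t a))) (nhds (0::complex))"
    using r by (intro eventually_nhds_in_open) (auto simp: zero_ereal_def)
  with e show ?thesis
    unfolding eventually_at_filter
  proof eventually_elim
    case (elim x)
    then have "(\<lambda>k. fps_nth (barnes_fps t a) k * x ^ k) sums eval_fps (barnes_fps t a) x"
      by (intro sums_eval_fps) simp
    with elim show ?case
      by (auto simp: barnes_poly_def)
  qed
qed

definition trinomial :: "nat \<Rightarrow> nat \<Rightarrow> nat \<Rightarrow> complex" where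
  "trinomial n r j = fact n / (fact r * fact j * fact (n - r - j))"

text \<open>\<open>c 0, \<dots>, c d\<close> are the quasi-coefficients of the counting function: its coefficients
  as a quasi-polynomial in the real variable \<open>t > 0\<close>. Periodicity in \<open>t\<close> is what makes
  them unique.\<close>

definition ehrhart_quasi_coeffs :: "(real ^ 'n) set \<Rightarrow> (nat \<Rightarrow> real \<Rightarrow> real) \<Rightarrow> bool" where
  "ehrhart_quasi_coeffs P c \<longleftrightarrow>
     (\<exists>q::nat. q > 0 \<and> (\<forall>r \<le> CARD('n). \<forall>t>0. c r (t + real q) = c r t)) \<and>
     (\<forall>t>0. real (lattice_count P t) = (\<Sum>r\<le>CARD('n). c r t * t ^ r))"

text \<open>The points of the translated lattice \<open>\<int>\<^sup>d - y\<close> in the half-open parallelepiped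
  spanned by \<open>w\<close>.\<close>

definition pped_points :: "('n \<Rightarrow> real ^ 'n) \<Rightarrow> real ^ 'n \<Rightarrow> (real ^ 'n) set" where
  "pped_points w y = (\<lambda>q. q - y) ` int_lattice \<inter> half_open_pped w"

definition edge_pairings :: "('n \<Rightarrow> real ^ 'n) \<Rightarrow> complex ^ 'n \<Rightarrow> complex ^ 'n" where
  "edge_pairings w z = (\<chi> k. pairing (w k) z)"

text \<open>The exact meaning of ``almost all \<open>z\<close>'', for edge vectors \<open>w v k\<close> at the
  vertices \<open>v\<close> of \<open>P\<close>.\<close>

definition generic ::
    "(real ^ 'n) set \<Rightarrow> (real ^ 'n \<Rightarrow> 'n \<Rightarrow> real ^ 'n) \<Rightarrow> complex ^ 'n \<Rightarrow> bool" where
  "generic P w z \<longleftrightarrow>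
     (\<forall>v \<in> vertices P. \<forall>k. \<forall>m::int. pairing (w v k) z \<noteq> 2 * complex_of_real pi * \<i> * of_int m)"

end

theory Submission
  imports Defs "HOL-Complex_Analysis.Complex_Analysis"
begin

text \<open>For a real direction \<open>\<xi>\<close> that is nonconstant on every edge, each nonempty face of \<open>P\<close> has a unique
  \<open>\<xi>\<close>-minimal vertex. Charging faces to these vertices turns an alternating sum over faces into a
  signed sum over vertices of flipped tangent cones; the face sum does not involve \<open>\<xi>\<close>, so the vertex
  sum can be evaluated with any convenient direction, and it is the indicator function of \<open>P\<close>
  (Lawrence--Varchenko). Summing \<open>exp \<langle>q, z\<rangle>\<close> over lattice points gives geometric series
  in each cone and hence Brion's formula for those \<open>z\<close> whose real part is opposite to \<open>\<xi>\<close>; analytic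
  continuation along \<open>z + s \<xi>\<close> gives it for all \<open>z\<close> off the poles. The lattice point count is the
  coefficient of \<open>x\<^sup>d\<close> in \<open>x\<^sup>d\<close> times Brion's formula at \<open>x z\<close>. The
  quasi-coefficients come from expanding \<open>B\<^sub>k(t\<langle>v, z\<rangle>)\<close> in powers of \<open>t\<close>, and they are unique
  because a polynomial vanishing on an arithmetic progression is zero.\<close>

section \<open>Edge directions at a vertex\<close>

text \<open>No single z makes the exponential series of all tangent cones converge, because an edge
  of \<open>P\<close> points in opposite directions at its two ends; this forces the flips.
  Simplicity works through coordinates: the edge vectors at a vertex v form a basis, so the faces
  through v correspond to sets K of edge directions, with dimension the cardinality of K. The faces
  charged to v in the alternating sum then form an interval of sets, over which the signs cancel
  unless its two ends coincide. The decomposition is proved for \<open>P\<close> alone and pulled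
  back by scaling, so real t is no harder than integral t. At x z each vertex term of Brion's
  formula may have a pole of order d at x = 0; the factor x^d turns it into a Barnes series times a
  sum of exponentials. Genericity of z says in particular that the pairings with edge vectors are
  nonzero, which makes the Barnes series meaningful and keeps x z off the poles for all small
  nonzero x.\<close>

lemma extreme_point_of_subset:
  assumes "v extreme_point_of S" "v \<in> T" "T \<subseteq> S"
  shows "v extreme_point_of T"
  using assms unfolding extreme_point_of_def by blast

text \<open>A hyperplane cuts v off from the other vertices. The vertices of the section
  \<open>?Q\<close> lie on edges through v, so the section seen from v lies in \<open>C\<close>. The
  segment from v to any other vertex crosses the section, and \<open>C\<close> is a cone, so it
  contains the direction of that segment too.\<close>

lemma polytope_subset_vertex_cone:
  fixes P :: "'a::euclidean_space set"
  assumes P: "polytope P" and v: "v extreme_point_of P" and x: "x \<in> P"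
    and conv: "convex C" and cone: "cone C" and C0: "0 \<in> C"
    and edge: "\<And>e y. e edge_of P \<Longrightarrow> v \<in> e \<Longrightarrow> y \<in> e \<Longrightarrow> y - v \<in> C"
  shows "x - v \<in> C"
proof -
  let ?W = "{u. u extreme_point_of P}"
  have cP: "compact P" "convex P"
    using P by (auto simp: polytope_imp_compact polytope_imp_convex)
  have finW: "finite ?W"
    using P by (simp add: finite_polyhedron_extreme_points polytope_imp_polyhedron)
  have hullW: "P = convex hull ?W"
    by (rule Krein_Milman_Minkowski[OF cP])
  have vP: "v \<in> P" using v by (simp add: extreme_point_of_def)
  have trC: "{x. x - v \<in> C} = (+) v ` C"
    by (auto simp: image_iff) (metis add_diff_cancel_left' diff_add_cancel add.commute)
  have convC: "convex {x. x - v \<in> C}"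
    unfolding trC using conv by (rule convex_translation)
  have vC: "v \<in> {x. x - v \<in> C}" using C0 by simp
  have "v \<notin> convex hull (?W - {v})"
  proof
    assume a: "v \<in> convex hull (?W - {v})"
    have "convex hull (?W - {v}) \<subseteq> P"
      using hullW by (metis Diff_subset hull_mono)
    then have "v extreme_point_of (convex hull (?W - {v}))"
      using extreme_point_of_subset[OF v a] by blast
    then have "v \<in> ?W - {v}" by (rule extreme_point_of_convex_hull)
    then show False by simp
  qed
  moreover have "closed (convex hull (?W - {v}))"
    using finW by (simp add: compact_imp_closed finite_imp_compact_convex_hull)
  ultimately obtain a b where av: "a \<bullet> v < b" and ab: "\<forall>x\<in>convex hull (?W - {v}). a \<bullet> x > b"
    using separating_hyperplane_closed_point[of "convex hull (?W - {v})" v] by auto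
  let ?Q = "P \<inter> {x. a \<bullet> x = b}"
  have pQ: "polytope ?Q"
    using P polyhedron_hyperplane by (rule polytope_Int_polyhedron)
  have extQ: "p - v \<in> C" if p: "p extreme_point_of ?Q" for p
  proof -
    have pP: "p \<in> P" and pb: "a \<bullet> p = b" using p by (auto simp: extreme_point_of_def)
    \<comment> \<open>The smallest face through p: a facet of it through p would be smaller still,
      so p lies in its relative interior.\<close>
    define F where "F = \<Inter>{F. F face_of P \<and> p \<in> F}"
    have ne: "{F. F face_of P \<and> p \<in> F} \<noteq> {}"
      using face_of_refl[OF cP(2)] pP by blast
    have FP: "F face_of P"
      unfolding F_def by (rule face_of_Inter[OF ne]) blast
    have pF: "p \<in> F" unfolding F_def by blast
    have Fsub: "F \<subseteq> P" by (rule face_of_imp_subset[OF FP])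
    have pri: "p \<in> rel_interior F"
    proof (rule ccontr)
      assume "p \<notin> rel_interior F"
      then have "p \<in> F - rel_interior F" using pF by simp
      moreover have "polyhedron F"
        using P FP face_of_polytope_polytope polytope_imp_polyhedron by blast
      ultimately obtain G where G: "G facet_of F" "p \<in> G"
        using rel_boundary_of_polyhedron by blast
      then have "G face_of P" using FP face_of_trans facet_of_imp_face_of by blast
      then have "F \<subseteq> G" unfolding F_def using G by blast
      moreover have "G \<subseteq> F" using G facet_of_imp_subset by blast
      ultimately show False using G facet_of_irrefl by auto
    qed
    have cF: "compact F" "convex F"
      using FP cP face_of_imp_compact face_of_imp_convex by blast+
    \<comment> \<open>Otherwise all vertices of \<open>F\<close>, and hence p, lie strictly on the
      far side of the hyperplane.\<close>
    have vF: "v \<in> F"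
    proof (rule ccontr)
      assume "v \<notin> F"
      then have "{u. u extreme_point_of F} \<subseteq> ?W - {v}"
        using extreme_point_of_face[OF FP] by auto
      then have "convex hull {u. u extreme_point_of F} \<subseteq> convex hull (?W - {v})"
        by (rule hull_mono)
      then have "p \<in> convex hull (?W - {v})"
        using Krein_Milman_Minkowski[OF cF] pF by blast
      then show False using ab pb by fastforce
    qed
    obtain r where r: "r > 0" "cball p r \<inter> affine hull F \<subseteq> F"
      using pri by (auto simp: mem_rel_interior_cball)
    have line: "g \<in> affine hull {v, p}" if g: "g \<in> F" for g
    proof -
      \<comment> \<open>\<beta> corrects g - p by a multiple of v - p so that the result d is
        parallel to the hyperplane. If d were nonzero, p would be the midpoint of a segment in the
        section; so \<open>F\<close> lies on the line through v and p.\<close>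
      define \<beta> where "\<beta> = - (a \<bullet> (g - p)) / (a \<bullet> (v - p))"
      define d where "d = (g - p) + \<beta> *\<^sub>R (v - p)"
      have neg: "a \<bullet> (v - p) < 0" using av pb by (simp add: inner_diff_right)
      have ad: "a \<bullet> d = 0"
        using neg unfolding d_def inner_add_right inner_scaleR_right \<beta>_def by simp
      have aff: "p + c *\<^sub>R d \<in> affine hull F" for c
      proof -
        have "p + c *\<^sub>R d = (1 - c - c * \<beta>) *\<^sub>R p + c *\<^sub>R g + (c * \<beta>) *\<^sub>R v"
          by (simp add: d_def algebra_simps)
        also have "\<dots> \<in> affine hull F"
          by (rule mem_affine_3[OF affine_affine_hull]) (use pF g vF in \<open>auto simp: hull_inc\<close>)
        finally show ?thesis .
      qed
      have "d = 0"
      proof (rule ccontr)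
        assume d0: "d \<noteq> 0"
        define c where "c = r / norm d"
        have c: "c > 0" using d0 r by (simp add: c_def)
        have nc: "norm (c *\<^sub>R d) = r" using d0 r by (simp add: c_def)
        have "p + c *\<^sub>R d \<in> F" "p + (- c) *\<^sub>R d \<in> F"
          using r(2) aff[of c] aff[of "-c"] nc by (auto simp: dist_norm)
        then have "p + c *\<^sub>R d \<in> ?Q" "p - c *\<^sub>R d \<in> ?Q"
          using Fsub ad pb by (auto simp: inner_add_right inner_diff_right)
        moreover have "p \<in> open_segment (p - c *\<^sub>R d) (p + c *\<^sub>R d)"
        proof -
          have "p = midpoint (p - c *\<^sub>R d) (p + c *\<^sub>R d)"
            by (simp add: midpoint_def algebra_simps scaleR_2[symmetric])
          moreover have "p - c *\<^sub>R d \<noteq> p + c *\<^sub>R d"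
          proof
            assume "p - c *\<^sub>R d = p + c *\<^sub>R d"
            moreover have "(p + c *\<^sub>R d) - (p - c *\<^sub>R d) = (c + c) *\<^sub>R d"
              by (simp only: scaleR_add_left) simp
            ultimately have "(c + c) *\<^sub>R d = 0" by simp
            then show False using c d0 by simp
          qed
          ultimately show ?thesis using midpoint_in_open_segment by metis
        qed
        ultimately show False using p unfolding extreme_point_of_def by blast
      qed
      then have "g = p - \<beta> *\<^sub>R (v - p)" by (simp add: d_def algebra_simps)
      then have "g = (- \<beta>) *\<^sub>R v + (1 + \<beta>) *\<^sub>R p" by (simp add: algebra_simps)
      then show ?thesis
        unfolding affine_hull_2 mem_Collect_eq by (intro exI[of _ "-\<beta>"] exI[of _ "1+\<beta>"]) simp
    qed
    have vp: "v \<noteq> p" using av pb by auto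
    have "aff_dim F = 1"
    proof -
      have "aff_dim F \<le> aff_dim (affine hull {v, p})" by (rule aff_dim_subset) (use line in blast)
      also have "\<dots> = 1" using vp by (simp add: aff_dim_affine_hull aff_dim_2)
      finally have "aff_dim F \<le> 1" .
      moreover have "aff_dim {v, p} \<le> aff_dim F" by (rule aff_dim_subset) (use vF pF in blast)
      ultimately show ?thesis using vp by (simp add: aff_dim_2)
    qed
    then have "F edge_of P" using FP by (simp add: edge_of_def)
    then show ?thesis using edge vF pF by blast
  qed
  have QC: "y - v \<in> C" if "y \<in> ?Q" for y
  proof -
    have "?Q = convex hull {p. p extreme_point_of ?Q}"
      using pQ by (intro Krein_Milman_Minkowski) (auto simp: polytope_imp_compact polytope_imp_convex)
    moreover have "\<dots> \<subseteq> {x. x - v \<in> C}"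
      by (rule hull_minimal) (use extQ convC in auto)
    ultimately show ?thesis using that by blast
  qed
  have WC: "u - v \<in> C" if u: "u \<in> ?W" for u
  proof (cases "u = v")
    case True then show ?thesis using C0 by simp
  next
    case False
    have uP: "u \<in> P" using u by (simp add: extreme_point_of_def)
    have au: "a \<bullet> u > b" using ab u False by (simp add: hull_inc)
    define s where "s = (b - a \<bullet> v) / (a \<bullet> u - a \<bullet> v)"
    have s: "0 < s" "s < 1" using av au by (auto simp: s_def)
    have "(1 - s) *\<^sub>R v + s *\<^sub>R u \<in> P"
      using cP(2) vP uP s by (intro convexD) auto
    moreover have "(1 - s) *\<^sub>R v + s *\<^sub>R u = v + s *\<^sub>R (u - v)" by (simp add: algebra_simps)
    moreover have "a \<bullet> (v + s *\<^sub>R (u - v)) = b"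
      using av au by (simp add: s_def inner_add_right inner_diff_right)
    ultimately have "v + s *\<^sub>R (u - v) \<in> ?Q" by simp
    then have "s *\<^sub>R (u - v) \<in> C" using QC by fastforce
    then have "(1 / s) *\<^sub>R (s *\<^sub>R (u - v)) \<in> C"
      by (rule mem_cone[OF cone]) (use s in simp)
    then show ?thesis using s by simp
  qed
  have "P \<subseteq> {x. x - v \<in> C}"
    by (subst hullW) (rule hull_minimal, use WC convC in auto)
  then show ?thesis using x by blast
qed

section \<open>Rational edges and primitive vectors\<close>

lemma common_denominator:
  assumes "finite A" "A \<subseteq> (\<rat> :: real set)"
  shows "\<exists>N::nat. N > 0 \<and> (\<forall>x\<in>A. of_nat N * x \<in> \<int>)"
  using assms
proof (induction rule: finite_induct)
  case empty show ?case by (auto intro: exI[of _ 1])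
next
  case (insert x A)
  then obtain N where N: "N > 0" "\<forall>x\<in>A. real N * x \<in> \<int>" by auto
  from insert obtain a b :: int where "b > 0" "x = of_int a / of_int b"
    by (metis Rats_cases' insert_subset)
  then have "real (nat b) * x = of_int a" "nat b > 0" by auto
  then obtain k :: nat where k: "real k * x \<in> \<int>" "k > 0" by (metis Ints_of_int)
  have "real (N * k) * y \<in> \<int>" if "y \<in> insert x A" for y
  proof (cases "y = x")
    case True
    have "real N * (real k * x) \<in> \<int>" by (rule Ints_mult) (use k in auto)
    then show ?thesis using True by (simp add: mult.assoc)
  next
    case False
    then have "real k * (real N * y) \<in> \<int>" 
      by (intro Ints_mult[of "real k"]) (use that N in auto)
    then show ?thesis by (simp add: mult_ac)
  qed
  then show ?case using N k by (intro exI[of _ "N * k"]) auto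
qed

lemma ex_primitive_multiple:
  fixes u :: "real ^ 'n"
  assumes "\<And>i. u $ i \<in> \<rat>" "u \<noteq> 0"
  shows "\<exists>w s. primitive_vector w \<and> s > 0 \<and> u = s *\<^sub>R w"
proof -
  obtain N :: nat where N: "N > 0" "\<And>i. real N * u $ i \<in> \<int>"
    using common_denominator[of "range (\<lambda>i. u $ i)"] assms by auto
  then have "\<forall>i. \<exists>m. real N * u $ i = of_int m" by (auto elim!: Ints_cases)
  then obtain m where m: "\<And>i. real N * u $ i = of_int (m i)" by metis
  define g where "g = (GCD i. m i)"
  obtain i0 where "u $ i0 \<noteq> 0" using assms(2) by (metis vec_eq_iff zero_index)
  then have "m i0 \<noteq> 0" using m[of i0] N by auto
  then have "g \<noteq> 0" unfolding g_def by auto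
  moreover have "g \<ge> 0" unfolding g_def by simp
  ultimately have g: "g > 0" by simp
  define h where "h i = m i div g" for i
  have gdvd: "g dvd m i" for i unfolding g_def by auto
  have gh: "m i = g * h i" for i using gdvd[of i] by (simp add: h_def)
  have "(GCD i. h i) = 1"
  proof -
    define k where "k = (GCD i. h i)"
    have kdvd: "k dvd h i" for i unfolding k_def by auto
    have "g * k dvd m i" for i using kdvd[of i] gh[of i] by simp
    then have "g * k dvd (GCD i. m i)" by (intro Gcd_greatest) blast
    then have "g * k dvd g * 1" by (simp only: g_def mult_1_right)
    then have "k dvd 1" using g by (simp only: dvd_times_left_cancel_iff) 
    moreover have "k \<ge> 0" by (simp add: k_def)
    ultimately show ?thesis unfolding k_def[symmetric] by auto
  qed
  then have "primitive_vector (\<chi> i. real_of_int ((\<chi> i. h i) $ i))"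
    unfolding primitive_vector_def by (intro exI[of _ "\<chi> i. h i"]) simp
  moreover have "u = (of_int g / real N) *\<^sub>R (\<chi> i. real_of_int ((\<chi> i. h i) $ i))"
  proof -
    have "u $ i = of_int g / real N * of_int (h i)" for i
      using m[of i] N(1) by (simp add: gh field_simps)
    then show ?thesis by (simp add: vec_eq_iff)
  qed
  moreover have "of_int g / real N > 0" using g N by simp
  ultimately show ?thesis by blast
qed

text \<open>The other end u of the edge is a vertex of \<open>P\<close>, hence rational, so u - v is
  a positive multiple of a primitive vector. No point of the edge lies on the opposite side of v,
  since v is extreme.\<close>

lemma rational_edge_generator:
  fixes P :: "(real ^ 'n) set"
  assumes P: "rational_polytope P" and v: "v \<in> vertices P" and e: "e edge_of P" "v \<in> e"
  obtains b where "b \<in> primitive_edge_vectors P v" "\<And>y. y \<in> e \<Longrightarrow> \<exists>c\<ge>0. y - v = c *\<^sub>R b"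
proof -
  have pP: "polytope P" and rat: "\<And>u i. u \<in> vertices P \<Longrightarrow> u $ i \<in> \<rat>"
    using P by (auto simp: rational_polytope_def)
  have fe: "e face_of P" and de: "aff_dim e = 1" using e by (auto simp: edge_of_def)
  have "polytope e" using face_of_polytope_polytope pP fe by blast
  then have ce: "compact e" "convex e" by (auto simp: polytope_imp_compact polytope_imp_convex)
  have "\<not> {u. u extreme_point_of e} \<subseteq> {v}"
  proof
    assume "{u. u extreme_point_of e} \<subseteq> {v}"
    then have "e \<subseteq> convex hull {v}" using Krein_Milman_Minkowski[OF ce] hull_mono by metis
    then have "aff_dim e \<le> aff_dim {v}" by (intro aff_dim_subset) simp
    then show False using de by simp
  qed
  then obtain u where u: "u extreme_point_of e" "u \<noteq> v" by blast
  have ue: "u \<in> e" and uV: "u \<in> vertices P"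
    using u extreme_point_of_face[OF fe] by (auto simp: vertices_def)
  obtain b s where bs: "primitive_vector b" "s > 0" "u - v = s *\<^sub>R b"
    using ex_primitive_multiple[of "u - v"] rat[OF uV] rat[OF v] u(2) by auto
  have "v + s *\<^sub>R b = u" using bs(3) by (metis add_diff_cancel_left' diff_add_cancel add.commute)
  then have bP: "b \<in> primitive_edge_vectors P v"
    unfolding primitive_edge_vectors_def using bs e ue by blast
  have "\<exists>c\<ge>0. y - v = c *\<^sub>R b" if y: "y \<in> e" for y
  proof -
    have "affine hull {v,u} = affine hull e"
      by (intro aff_dim_eq_full_gen[THEN iffD1] affine_dim_equal)
         (use ue e de u(2) in \<open>auto simp: aff_dim_2 hull_mono affine_affine_hull aff_dim_affine_hull\<close>)
    then have "y \<in> affine hull {v,u}" using y by (simp add: hull_inc)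
    then obtain p q where pq: "p + q = 1" "y = p *\<^sub>R v + q *\<^sub>R u" unfolding affine_hull_2 by blast
    have yv: "y - v = q *\<^sub>R (u - v)"
    proof -
      have "y = (1 - q) *\<^sub>R v + q *\<^sub>R u" using pq by (metis add_diff_cancel_right')
      then show ?thesis by (simp add: algebra_simps)
    qed
    have "q \<ge> 0"
    proof (rule ccontr)
      assume "\<not> q \<ge> 0"
      then have q: "q < 0" by simp
      \<comment> \<open>The solution of (1 - t) q + t = 0, which puts v strictly between y and
        u.\<close>
      define t where "t = (- q) / (1 - q)"
      have t: "0 < t" "t < 1" using q by (auto simp: t_def field_simps)
      have "v - ((1 - t) *\<^sub>R y + t *\<^sub>R u) = - ((1-t) *\<^sub>R (y - v) + t *\<^sub>R (u - v))"
        by (simp add: algebra_simps)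
      also have "\<dots> = - ((1 - t) * q + t) *\<^sub>R (u - v)"
        unfolding yv by (simp add: algebra_simps)
      also have "(1 - t) * q + t = 0" using q by (simp add: t_def field_simps)
      finally have "v = (1 - t) *\<^sub>R y + t *\<^sub>R u" by simp
      moreover have "y \<noteq> u"
      proof
        assume "y = u"
        then have "(1 - q) *\<^sub>R (u - v) = 0" using yv by (simp add: algebra_simps)
        then show False using q u(2) by simp
      qed
      ultimately have "v \<in> open_segment y u" using t in_segment(2) by blast
      moreover have "y \<in> P" "u \<in> P" using y ue fe face_of_imp_subset by blast+
      ultimately show False using v by (simp add: vertices_def extreme_point_of_def)
    qed
    then show ?thesis using yv bs by (intro exI[of _ "q * s"]) simp
  qed
  then show ?thesis using that bP by blast
qed

section \<open>Coordinates at a vertex and faces\<close>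

text \<open>Spanning is what the dimension count in \<open>frame\<close> delivers. The index type
  has as many elements as the space has dimensions, so injectivity and independence follow.\<close>

definition is_frame :: "('n \<Rightarrow> real ^ 'n) \<Rightarrow> bool" where
  "is_frame b \<longleftrightarrow> span (range b) = UNIV"

definition coord :: "('n \<Rightarrow> real ^ 'n) \<Rightarrow> real ^ 'n \<Rightarrow> 'n \<Rightarrow> real" where
  "coord b x k = representation (range b) x (b k)"

lemma is_frame_basis:
  fixes b :: "'n::finite \<Rightarrow> real ^ 'n"
  assumes "is_frame b"
  shows "inj b" "independent (range b)"
proof -
  have sp: "span (range b) = UNIV" using assms by (simp add: is_frame_def)
  have "dim (UNIV :: (real ^ 'n) set) \<le> card (range b)"
    using sp by (intro dim_le_card) auto
  then have ge: "CARD('n) \<le> card (range b)" by simp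
  moreover have "card (range b) \<le> CARD('n)" by (rule card_image_le) simp
  ultimately have eq: "card (range b) = CARD('n)" by simp
  show "inj b" by (rule eq_card_imp_inj_on) (use eq in auto)
  show "independent (range b)"
    by (rule card_le_dim_spanning[of _ UNIV]) (use eq sp in auto)
qed

lemma sum_coord:
  assumes "is_frame b"
  shows "(\<Sum>k\<in>UNIV. coord b x k *\<^sub>R b k) = x"
proof -
  have "(\<Sum>u\<in>range b. representation (range b) x u *\<^sub>R u) = x"
    using assms by (intro sum_representation_eq) (auto simp: is_frame_basis is_frame_def)
  then show ?thesis
    by (subst (asm) sum.reindex) (auto simp: is_frame_basis[OF assms] coord_def)
qed

lemma linear_coord:
  assumes "is_frame b"
  shows "linear (\<lambda>x. coord b x k)"
  using assms
  by (intro linearI) (auto simp: coord_def is_frame_basis representation_add representation_scale is_frame_def)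

lemma coord_frame:
  assumes "is_frame b"
  shows "coord b (b j) k = (if j = k then 1 else 0)"
  using is_frame_basis[OF assms]
  by (auto simp: coord_def representation_basis inj_eq)

lemma coord_simps:
  assumes "is_frame b"
  shows "coord b (x + y) k = coord b x k + coord b y k"
    "coord b (x - y) k = coord b x k - coord b y k"
    "coord b (r *\<^sub>R x) k = r * coord b x k"
    "coord b 0 k = 0"
  using linear_add[OF linear_coord[OF assms]] linear_diff[OF linear_coord[OF assms]]
    linear_scale[OF linear_coord[OF assms]] linear_0[OF linear_coord[OF assms]]
  by simp_all

lemma coord_sum:
  assumes "is_frame b"
  shows "coord b (\<Sum>j\<in>UNIV. c j *\<^sub>R b j) k = c k"
proof -
  have "coord b (\<Sum>j\<in>UNIV. c j *\<^sub>R b j) k = (\<Sum>j\<in>UNIV. c j * coord b (b j) k)"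
    by (subst linear_sum[OF linear_coord[OF assms]]) (simp add: coord_simps[OF assms])
  also have "\<dots> = c k"
    by (simp add: coord_frame[OF assms] mult_delta_right cong: if_cong)
  finally show ?thesis .
qed

lemma continuous_on_coord:
  assumes "is_frame b"
  shows "continuous_on UNIV (\<lambda>x. coord b (x - v) k)"
proof -
  have "continuous_on UNIV ((\<lambda>x. coord b x k) \<circ> (\<lambda>x. x - v))"
    using linear_coord[OF assms, of k]
    by (intro continuous_intros) (simp add: linear_continuous_on linear_conv_bounded_linear)
  then show ?thesis by (simp add: o_def)
qed

text \<open>With N = CARD('n), the point is the average of the N points v + (N c_k) b_k, each of
  which is v or lies on a segment from v to a given point of \<open>G\<close>. This explains the
  factor N in \<delta>. It is applied to \<open>P\<close> with all directions and to a face with the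
  directions that the face contains.\<close>

lemma convex_near_vertex:
  fixes b :: "'n::finite \<Rightarrow> 'a::real_vector"
  assumes G: "convex G" "v \<in> G" and K: "\<And>k. k \<in> K \<Longrightarrow> \<exists>s>0. v + s *\<^sub>R b k \<in> G"
  shows "\<exists>\<delta>>0. \<forall>c. (\<forall>k. 0 \<le> c k \<and> c k \<le> \<delta>) \<longrightarrow> (\<forall>k. k \<notin> K \<longrightarrow> c k = 0)
           \<longrightarrow> v + (\<Sum>k\<in>UNIV. c k *\<^sub>R b k) \<in> G"
proof -
  obtain s where s: "\<And>k. k \<in> K \<Longrightarrow> s k > 0 \<and> v + s k *\<^sub>R b k \<in> G"
    using K by metis
  define s' where "s' k = (if k \<in> K then s k else 1)" for k
  have s': "s' k > 0" for k using s by (simp add: s'_def)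
  define \<delta> where "\<delta> = Min (range s') / real CARD('n)"
  have \<delta>: "\<delta> > 0" using s' by (auto simp: \<delta>_def)
  have "v + (\<Sum>k\<in>UNIV. c k *\<^sub>R b k) \<in> G"
    if c: "\<And>k. 0 \<le> c k \<and> c k \<le> \<delta>" "\<And>k. k \<notin> K \<Longrightarrow> c k = 0" for c
  proof -
    have pt: "v + (real CARD('n) * c k) *\<^sub>R b k \<in> G" for k
    proof (cases "k \<in> K")
      case True
      define t where "t = real CARD('n) * c k / s k"
      have "real CARD('n) * c k \<le> Min (range s')"
        using c(1)[of k] by (simp add: \<delta>_def field_simps)
      also have "\<dots> \<le> s' k" by simp
      finally have "real CARD('n) * c k \<le> s k" using True by (simp add: s'_def)
      then have t: "0 \<le> t" "t \<le> 1" using s[OF True] c(1)[of k] by (auto simp: t_def field_simps)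
      have "(1 - t) *\<^sub>R v + t *\<^sub>R (v + s k *\<^sub>R b k) \<in> G"
        using G s[OF True] t by (intro convexD) auto
      moreover have "(1 - t) *\<^sub>R v + t *\<^sub>R (v + s k *\<^sub>R b k) = v + (t * s k) *\<^sub>R b k"
        by (simp add: algebra_simps)
      moreover have "t * s k = real CARD('n) * c k" using s[OF True] by (simp add: t_def)
      ultimately show ?thesis by simp
    next
      case False then show ?thesis using c G by simp
    qed
    have "(\<Sum>k\<in>(UNIV::'n set). (1 / real CARD('n)) *\<^sub>R (v + (real CARD('n) * c k) *\<^sub>R b k)) \<in> G"
      using G(1) pt by (intro convex_sum) auto
    also have "(\<Sum>k\<in>(UNIV::'n set). (1 / real CARD('n)) *\<^sub>R (v + (real CARD('n) * c k) *\<^sub>R b k))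
        = v + (\<Sum>k\<in>UNIV. c k *\<^sub>R b k)"
      by (simp add: scaleR_add_right sum.distrib sum_constant_scaleR)
    finally show ?thesis .
  qed
  then show ?thesis using \<delta> by blast
qed

text \<open>If A is a proper subset of B, the sets in between of even and of odd size are equally
  many. In \<open>sum_contributes\<close>, A collects the nonnegative coordinates of x and B the
  ascending edges.\<close>

lemma sum_neg_one_between:
  assumes "finite B"
  shows "(\<Sum>K | A \<subseteq> K \<and> K \<subseteq> B. (-1) ^ card K) = (if A = B then (-1) ^ card B else (0::complex))"
proof (cases "A \<subset> B")
  case True
  have fin: "finite {K. A \<subseteq> K \<and> K \<subseteq> B}" by (rule finite_subset[of _ "Pow B"]) (use assms in auto)
  have "(\<Sum>K | A \<subseteq> K \<and> K \<subseteq> B. (-1) ^ card K) = (0::complex)"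
    using card_subsupersets_even_odd[OF assms True]
    by (intro sum_alternating_cancels[OF fin]) (simp add: conj_ac)
  then show ?thesis using True by auto
next
  case False
  show ?thesis
  proof (cases "A = B")
    case True
    then have "{K. A \<subseteq> K \<and> K \<subseteq> B} = {B}" by auto
    then show ?thesis using True by simp
  next
    case neq: False
    then have "{K. A \<subseteq> K \<and> K \<subseteq> B} = {}" using False by auto
    then show ?thesis using neq by (simp only: sum.empty if_False)
  qed
qed

text \<open>Simplicity is contained in \<open>edge_vectors\<close>, which indexes the primitive edge vectors at each
  vertex by the \<open>CARD('n)\<close> elements of \<open>'n\<close>.\<close>

locale rational_simple_polytope =
  fixes P :: "(real ^ 'n) set" and w :: "real ^ 'n \<Rightarrow> 'n \<Rightarrow> real ^ 'n"
  assumes rational: "rational_polytope P"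
    and full_dim: "aff_dim P = int CARD('n)"
    and edge_vectors: "\<And>v. v \<in> vertices P \<Longrightarrow> bij_betw (w v) UNIV (primitive_edge_vectors P v)"
begin

lemma polytope: "polytope P" and convexP: "convex P" and compactP: "compact P"
  using rational by (auto simp: rational_polytope_def polytope_imp_convex polytope_imp_compact)

lemma finite_vertices: "finite (vertices P)"
  unfolding vertices_def using polytope
  by (simp add: finite_polyhedron_extreme_points polytope_imp_polyhedron)

lemma vertex_in: "v \<in> vertices P \<Longrightarrow> v \<in> P"
  by (simp add: vertices_def extreme_point_of_def)

lemma edge_point:
  assumes "v \<in> vertices P"
  shows "\<exists>s>0. v + s *\<^sub>R w v k \<in> P"
proof -
  have "w v k \<in> primitive_edge_vectors P v"
    using edge_vectors[OF assms] by (auto simp: bij_betw_def)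
  then show ?thesis
    unfolding primitive_edge_vectors_def using edge_of_imp_subset by blast
qed

lemma vertex_cone:
  assumes v: "v \<in> vertices P" and x: "x \<in> P"
  shows "\<exists>c. (\<forall>k. 0 \<le> c k) \<and> x - v = (\<Sum>k\<in>UNIV. c k *\<^sub>R w v k)"
proof -
  let ?C = "{y. \<exists>c. (\<forall>k. 0 \<le> c k) \<and> y = (\<Sum>k\<in>UNIV. c k *\<^sub>R w v k)}"
  have add: "y + z \<in> ?C" if yz: "y \<in> ?C" "z \<in> ?C" for y z
  proof -
    obtain c d where "\<forall>k. 0 \<le> c k" "y = (\<Sum>k\<in>UNIV. c k *\<^sub>R w v k)"
      "\<forall>k. 0 \<le> d k" "z = (\<Sum>k\<in>UNIV. d k *\<^sub>R w v k)" using yz by auto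
    then show ?thesis
      by (auto intro!: exI[of _ "\<lambda>k. c k + d k"] simp: scaleR_add_left sum.distrib)
  qed
  have cone: "cone ?C"
    unfolding cone_def
  proof (intro ballI allI impI)
    fix y and r :: real assume "y \<in> ?C" "0 \<le> r"
    then obtain c where "\<forall>k. 0 \<le> c k" "y = (\<Sum>k\<in>UNIV. c k *\<^sub>R w v k)" by auto
    then show "r *\<^sub>R y \<in> ?C"
      using \<open>0 \<le> r\<close> by (auto intro!: exI[of _ "\<lambda>k. r * c k"] simp: scaleR_sum_right)
  qed
  have conv: "convex ?C"
    by (rule convexI) (intro add mem_cone[OF cone], auto)
  have C0: "0 \<in> ?C" by (auto intro!: exI[of _ "\<lambda>_. 0"])
  have "x - v \<in> ?C"
  proof (rule polytope_subset_vertex_cone[OF polytope _ x conv cone C0])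
    show "v extreme_point_of P" using v by (simp add: vertices_def)
    fix e y assume e: "e edge_of P" "v \<in> e" "y \<in> e"
    obtain b where b: "b \<in> primitive_edge_vectors P v" "\<And>y. y \<in> e \<Longrightarrow> \<exists>c\<ge>0. y - v = c *\<^sub>R b"
      using rational_edge_generator[OF rational v e(1,2)] by blast
    obtain c where c: "c \<ge> 0" "y - v = c *\<^sub>R b" using b(2)[OF e(3)] by blast
    obtain k where k: "b = w v k"
      using b(1) edge_vectors[OF v] by (auto simp: bij_betw_def)
    have "c *\<^sub>R w v k = (\<Sum>j\<in>UNIV. (if j = k then c else 0) *\<^sub>R w v j)"
      by (simp add: if_distrib[of "\<lambda>r. r *\<^sub>R _"] cong: if_cong)
    then show "y - v \<in> ?C" using c k
      by (auto intro!: exI[of _ "\<lambda>j. if j = k then c else 0"])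
  qed
  then show ?thesis by simp
qed

text \<open>\<open>P\<close> lies in the translate by v of the span of the edge vectors, so full
  dimension of \<open>P\<close> forces this span to be the whole space.\<close>

lemma frame:
  assumes v: "v \<in> vertices P"
  shows "is_frame (w v)"
proof -
  let ?S = "span (range (w v))"
  have "x \<in> (+) v ` ?S" if x: "x \<in> P" for x
  proof -
    obtain c where "x - v = (\<Sum>k\<in>UNIV. c k *\<^sub>R w v k)" using vertex_cone[OF v x] by blast
    moreover have "(\<Sum>k\<in>UNIV. c k *\<^sub>R w v k) \<in> ?S"
      by (intro span_sum span_scale span_base) auto
    ultimately have "x - v \<in> ?S" by simp
    then show ?thesis by (auto intro!: image_eqI[of _ _ "x - v"])
  qed
  then have "aff_dim P \<le> aff_dim ((+) v ` ?S)" by (intro aff_dim_subset) auto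
  also have "\<dots> = int (dim ?S)" by (simp only: aff_dim_translation_eq aff_dim_subspace subspace_span)
  finally have "dim ?S = CARD('n)" using full_dim dim_subset_UNIV[of ?S] by simp
  then show ?thesis unfolding is_frame_def using dim_eq_full[of "range (w v)"] by (simp add: dim_span)
qed

lemma coord_nonneg:
  assumes "v \<in> vertices P" "x \<in> P"
  shows "0 \<le> coord (w v) (x - v) k"
  using vertex_cone[OF assms] coord_sum[OF frame[OF assms(1)]] by metis

lemma near_vertex:
  assumes v: "v \<in> vertices P"
  obtains \<delta> where "\<delta> > 0" "\<And>x. (\<And>k. 0 \<le> coord (w v) (x - v) k) \<Longrightarrow>
    (\<And>k. coord (w v) (x - v) k \<le> \<delta>) \<Longrightarrow> x \<in> P"
proof -
  obtain \<delta> where \<delta>: "\<delta> > 0" and *: "\<And>c. (\<forall>k. 0 \<le> c k \<and> c k \<le> \<delta>) \<Longrightarrow>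
      (\<forall>k. k \<notin> UNIV \<longrightarrow> c k = 0) \<Longrightarrow> v + (\<Sum>k\<in>UNIV. c k *\<^sub>R w v k) \<in> P"
    using convex_near_vertex[OF convexP vertex_in[OF v], of UNIV "w v"] edge_point[OF v] by blast
  show ?thesis
  proof (rule that[OF \<delta>])
    fix x assume "\<And>k. 0 \<le> coord (w v) (x - v) k" "\<And>k. coord (w v) (x - v) k \<le> \<delta>"
    then have "v + (\<Sum>k\<in>UNIV. coord (w v) (x - v) k *\<^sub>R w v k) \<in> P" by (intro *) auto
    then show "x \<in> P" by (simp add: sum_coord[OF frame[OF v]])
  qed
qed

section \<open>Faces through a vertex as sets of edge directions\<close>

definition vface :: "real ^ 'n \<Rightarrow> 'n set \<Rightarrow> (real ^ 'n) set" where
  "vface v K = {x \<in> P. \<forall>k. k \<notin> K \<longrightarrow> coord (w v) (x - v) k = 0}"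

text \<open>At a vertex v, \<open>dirs\<close> and \<open>vface v\<close> are mutually inverse
  between the faces through v and the subsets of the index type; see \<open>dirs_vface\<close> and
  \<open>face_eq_vface\<close>.\<close>

definition dirs :: "(real ^ 'n) set \<Rightarrow> real ^ 'n \<Rightarrow> 'n set" where
  "dirs G v = {k. \<exists>s>0. v + s *\<^sub>R w v k \<in> G}"

lemma vertex_in_vface: "v \<in> vertices P \<Longrightarrow> v \<in> vface v K"
  by (simp add: vface_def vertex_in coord_simps[OF frame])

text \<open>The coordinates at v are nonnegative on \<open>P\<close>, and a proper convex
  combination of two nonnegative numbers vanishes only if both do.\<close>

lemma vface_face_of:
  assumes v: "v \<in> vertices P"
  shows "vface v K face_of P"
  unfolding face_of_def
proof (intro conjI ballI impI)
  note f = frame[OF v]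
  have comb: "coord (w v) ((1 - u) *\<^sub>R a + u *\<^sub>R b - v) k
      = (1 - u) * coord (w v) (a - v) k + u * coord (w v) (b - v) k" for a b u k
    by (simp add: coord_simps[OF f] algebra_simps)
  show "vface v K \<subseteq> P" by (auto simp: vface_def)
  show "convex (vface v K)"
    unfolding convex_alt using convexP
    by (auto simp: vface_def comb convex_alt)
  have *: "coord (w v) (a - v) k = 0 \<and> coord (w v) (b - v) k = 0"
    if ab: "a \<in> P" "b \<in> P" and x: "x \<in> vface v K" "x \<in> open_segment a b" and k: "k \<notin> K" for a b x k
  proof -
    obtain u where u: "0 < u" "u < 1" "x = (1 - u) *\<^sub>R a + u *\<^sub>R b"
      using x(2) by (auto simp: in_segment)
    have "(1 - u) * coord (w v) (a - v) k + u * coord (w v) (b - v) k = 0"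
      using x(1) k unfolding vface_def u(3) comb[symmetric] by blast
    moreover have "0 \<le> (1 - u) * coord (w v) (a - v) k" "0 \<le> u * coord (w v) (b - v) k"
      using u ab coord_nonneg[OF v] by auto
    ultimately have "(1 - u) * coord (w v) (a - v) k = 0" "u * coord (w v) (b - v) k = 0"
      by linarith+
    then show ?thesis using u by auto
  qed
  fix a b x assume "a \<in> P" "b \<in> P" "x \<in> vface v K" "x \<in> open_segment a b"
  then show "a \<in> vface v K" "b \<in> vface v K"
    using *[of a b x] by (auto simp: vface_def)
qed

lemma dirs_vface:
  assumes v: "v \<in> vertices P"
  shows "dirs (vface v K) v = K"
proof (intro set_eqI iffI)
  note f = frame[OF v]
  fix k
  { assume "k \<in> dirs (vface v K) v"
    then obtain s where s: "s > 0" "v + s *\<^sub>R w v k \<in> vface v K" by (auto simp: dirs_def)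
    have "coord (w v) (v + s *\<^sub>R w v k - v) k = s"
      by (simp add: coord_simps[OF f] coord_frame[OF f])
    then show "k \<in> K" using s by (force simp: vface_def) }
  { assume "k \<in> K"
    obtain s where s: "s > 0" "v + s *\<^sub>R w v k \<in> P" using edge_point[OF v] by blast
    then have "v + s *\<^sub>R w v k \<in> vface v K"
      using \<open>k \<in> K\<close> by (auto simp: vface_def coord_simps[OF f] coord_frame[OF f])
    then show "k \<in> dirs (vface v K) v" using s by (auto simp: dirs_def) }
qed

text \<open>Both inclusions apply the defining property of a face to a segment in \<open>P\<close>,
  one of whose inner points is known to lie in \<open>G\<close>. Near v such segments can be built
  because \<open>P\<close> contains a full coordinate box there.\<close>

lemma face_eq_vface:
  assumes v: "v \<in> vertices P" and G: "G face_of P" "v \<in> G"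
  shows "G = vface v (dirs G v)"
proof (intro set_eqI iffI)
  note f = frame[OF v]
  have cG: "convex G" and GP: "G \<subseteq> P"
    using G by (auto simp: face_of_imp_convex face_of_imp_subset)
  fix x
  { assume x: "x \<in> G"
    have "k \<in> dirs G v" if k: "coord (w v) (x - v) k \<noteq> 0" for k
    proof -
      define l where "l = coord (w v) (x - v)"
      have lnn: "0 \<le> l j" for j unfolding l_def using coord_nonneg[OF v] x GP by blast
      have lk: "l k > 0" using k lnn[of k] by (simp add: l_def)
      obtain \<delta> where \<delta>: "\<delta> > 0" and near: "\<And>x. (\<And>k. 0 \<le> coord (w v) (x - v) k) \<Longrightarrow>
        (\<And>k. coord (w v) (x - v) k \<le> \<delta>) \<Longrightarrow> x \<in> P" using near_vertex[OF v] by metis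
      define M where "M = (\<Sum>j\<in>UNIV. l j)"
      have lM: "l j \<le> M" for j unfolding M_def by (rule member_le_sum) (use lnn in auto)
      have M: "M > 0" using lk lM[of k] by simp
      \<comment> \<open>Shrinking x - v by \<epsilon> brings all coordinates down to at most
        \<delta>, so a (the k-th coordinate alone) and b (all the others) lie in \<open>P\<close>.
        Their midpoint is on the segment from v to x, hence in \<open>G\<close>, and so a is in
        \<open>G\<close>.\<close>
      define \<epsilon> where "\<epsilon> = min 1 (\<delta> / M)"
      have \<epsilon>: "0 < \<epsilon>" "\<epsilon> \<le> 1" using \<delta> M by (auto simp: \<epsilon>_def)
      have el: "\<epsilon> * l j \<le> \<delta>" for j
      proof -
        have "\<epsilon> * l j \<le> (\<delta> / M) * M" using lM[of j] lnn[of j] \<delta> M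
          by (intro mult_mono) (auto simp: \<epsilon>_def)
        then show ?thesis using M by simp
      qed
      define a where "a = v + (\<epsilon> * l k) *\<^sub>R w v k"
      define b where "b = v + \<epsilon> *\<^sub>R (x - v) - (\<epsilon> * l k) *\<^sub>R w v k"
      have ca: "coord (w v) (a - v) j = (if j = k then \<epsilon> * l k else 0)" for j
        by (simp add: a_def coord_simps[OF f] coord_frame[OF f])
      have cb: "coord (w v) (b - v) j = (if j = k then 0 else \<epsilon> * l j)" for j
      proof -
        have "b - v = \<epsilon> *\<^sub>R (x - v) - (\<epsilon> * l k) *\<^sub>R w v k" by (simp add: b_def)
        then show ?thesis by (auto simp: coord_simps(2,3)[OF f] coord_frame[OF f] l_def simp del: diff_self)
      qed
      have "a \<in> P" by (rule near) (use \<epsilon> lnn el \<delta> in \<open>auto simp: ca\<close>)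
      moreover have "b \<in> P" by (rule near) (use \<epsilon> lnn el \<delta> in \<open>auto simp: cb\<close>)
      moreover have "midpoint a b \<in> open_segment a b"
      proof -
        have "coord (w v) (a - v) k \<noteq> coord (w v) (b - v) k" using \<epsilon> lk by (simp add: ca cb)
        then show ?thesis by (auto simp: midpoint_in_open_segment)
      qed
      moreover have "midpoint a b \<in> G"
      proof -
        have "a + b = 2 *\<^sub>R v + \<epsilon> *\<^sub>R (x - v)" by (simp add: a_def b_def scaleR_2)
        then have "midpoint a b = v + (\<epsilon>/2) *\<^sub>R (x - v)"
          by (simp add: midpoint_def scaleR_add_right)
        then have "midpoint a b = (1 - \<epsilon>/2) *\<^sub>R v + (\<epsilon>/2) *\<^sub>R x"
          by (simp add: algebra_simps)
        then show ?thesis using cG G(2) x \<epsilon> by (auto intro!: convexD)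
      qed
      ultimately have "a \<in> G" using G(1) unfolding face_of_def by blast
      then show ?thesis unfolding dirs_def a_def using \<epsilon> lk by (auto intro!: exI[of _ "\<epsilon> * l k"])
    qed
    then show "x \<in> vface v (dirs G v)" using x GP by (auto simp: vface_def) }
  { assume x: "x \<in> vface v (dirs G v)"
    then have xP: "x \<in> P" by (simp add: vface_def)
    show "x \<in> G"
    proof (cases "x = v")
      case True then show ?thesis using G by simp
    next
      case False
      define l where "l = coord (w v) (x - v)"
      have lnn: "0 \<le> l j" for j unfolding l_def using coord_nonneg[OF v xP] by blast
      have l0: "l k = 0" if "k \<notin> dirs G v" for k using x that by (simp add: vface_def l_def)
      obtain \<delta> where \<delta>: "\<delta> > 0" and near: "\<And>c. (\<forall>k. 0 \<le> c k \<and> c k \<le> \<delta>) \<Longrightarrow>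
        (\<forall>k. k \<notin> dirs G v \<longrightarrow> c k = 0) \<Longrightarrow> v + (\<Sum>k\<in>UNIV. c k *\<^sub>R w v k) \<in> G"
        using convex_near_vertex[OF cG G(2), of "dirs G v" "w v"] by (auto simp: dirs_def)
      define M where "M = (\<Sum>j\<in>UNIV. l j)"
      have lM: "l j \<le> M" for j unfolding M_def by (rule member_le_sum) (use lnn in auto)
      have M: "M \<ge> 0" using lnn lM order_trans by blast
      \<comment> \<open>The bound 1/2 keeps the new point strictly between v and x, as the face
        property requires; M + 1 is a positive bound for the coordinates.\<close>
      define \<epsilon> where "\<epsilon> = min (1/2) (\<delta> / (M + 1))"
      have \<epsilon>: "0 < \<epsilon>" "\<epsilon> < 1" using \<delta> M by (auto simp: \<epsilon>_def)
      have el: "\<epsilon> * l j \<le> \<delta>" for j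
      proof -
        have "\<epsilon> * l j \<le> (\<delta> / (M+1)) * (M+1)" using lM[of j] lnn[of j] \<delta> M
          by (intro mult_mono) (auto simp: \<epsilon>_def)
        then show ?thesis using M by simp
      qed
      have "v + (\<Sum>k\<in>UNIV. (\<epsilon> * l k) *\<^sub>R w v k) \<in> G"
        by (rule near) (use \<epsilon> lnn el l0 in auto)
      also have "(\<Sum>k\<in>UNIV. (\<epsilon> * l k) *\<^sub>R w v k) = \<epsilon> *\<^sub>R (x - v)"
        using sum_coord[OF f, of "x - v"] by (simp add: l_def flip: scaleR_scaleR scaleR_sum_right)
      also have "v + \<epsilon> *\<^sub>R (x - v) = (1 - \<epsilon>) *\<^sub>R v + \<epsilon> *\<^sub>R x" by (simp add: algebra_simps)
      finally have mG: "(1 - \<epsilon>) *\<^sub>R v + \<epsilon> *\<^sub>R x \<in> G" .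
      moreover have "(1 - \<epsilon>) *\<^sub>R v + \<epsilon> *\<^sub>R x \<in> open_segment v x"
        using \<epsilon> False by (auto simp: in_segment)
      ultimately show ?thesis using G(1) xP vertex_in[OF v] unfolding face_of_def by blast
    qed }
qed

lemma aff_dim_vface:
  assumes v: "v \<in> vertices P"
  shows "aff_dim (vface v K) = int (card K)"
proof -
  note f = frame[OF v]
  let ?D = "(\<lambda>x. x - v) ` vface v K"
  have "aff_dim (vface v K) = int (dim ?D)"
    by (rule aff_dim_eq_dim_subtract) (simp add: hull_inc vertex_in_vface[OF v])
  also have "dim ?D = card (w v ` K)"
  proof -
    have ind: "independent (w v ` K)"
      using is_frame_basis(2)[OF f] independent_mono by (metis image_mono subset_UNIV)
    have "span ?D = span (w v ` K)"
    proof (rule span_eq[THEN iffD2], intro conjI subsetI)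
      fix y assume "y \<in> ?D"
      then obtain x where x: "x \<in> vface v K" "y = x - v" by blast
      have "y = (\<Sum>k\<in>UNIV. coord (w v) y k *\<^sub>R w v k)" by (simp add: sum_coord[OF f])
      also have "\<dots> = (\<Sum>k\<in>K. coord (w v) y k *\<^sub>R w v k)"
        by (rule sum.mono_neutral_right) (use x in \<open>auto simp: vface_def\<close>)
      also have "\<dots> \<in> span (w v ` K)" by (intro span_sum span_scale span_base) auto
      finally show "y \<in> span (w v ` K)" .
    next
      fix y assume "y \<in> w v ` K"
      then obtain k where k: "k \<in> K" "y = w v k" by blast
      then obtain s where s: "s > 0" "v + s *\<^sub>R w v k \<in> vface v K"
        using dirs_vface[OF v, of K] by (auto simp: dirs_def)
      have "s *\<^sub>R w v k \<in> span ?D"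
        by (rule span_base) (use s in \<open>auto intro!: image_eqI[of _ _ "v + s *\<^sub>R w v k"]\<close>)
      then have "(1 / s) *\<^sub>R (s *\<^sub>R w v k) \<in> span ?D" by (rule span_scale)
      then show "y \<in> span ?D" using s k by simp
    qed
    then have "dim ?D = dim (w v ` K)" by (metis dim_span)
    then show ?thesis using ind by (simp add: dim_eq_card_independent)
  qed
  also have "card (w v ` K) = card K"
    using is_frame_basis(1)[OF f] by (metis card_image inj_on_subset subset_UNIV)
  finally show ?thesis .
qed

end

section \<open>The Lawrence--Varchenko decomposition\<close>

lemma avoid_hyperplanes:
  fixes W :: "'a::euclidean_space set"
  assumes "finite W" "0 \<notin> W" "r > 0"
  shows "\<exists>\<eta>\<in>ball \<xi> r. \<forall>u\<in>W. u \<bullet> \<eta> \<noteq> 0"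
proof -
  have "negligible (\<Union>u\<in>W. {x. u \<bullet> x = 0})"
    using assms by (intro negligible_Union) (auto intro!: negligible_hyperplane)
  moreover have "\<not> negligible (ball \<xi> r)"
    using assms by (intro open_not_negligible) auto
  ultimately have "\<not> ball \<xi> r \<subseteq> (\<Union>u\<in>W. {x. u \<bullet> x = 0})"
    using negligible_subset by blast
  then show ?thesis by auto
qed

context rational_simple_polytope
begin

text \<open>The point \<open>x\<close> violates every facet inequality that is tight on the face \<open>G\<close>, expressed without
  reference to facets: \<open>x\<close> is the far end of a segment that starts in the interior of \<open>P\<close>
  and passes through \<open>G\<close>.\<close>

definition beyond :: "(real ^ 'n) set \<Rightarrow> real ^ 'n \<Rightarrow> bool" where
  "beyond G x \<longleftrightarrow> (\<exists>y\<in>G. \<exists>\<epsilon>>0. y + \<epsilon> *\<^sub>R (y - x) \<in> interior P)"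

text \<open>A small step from u against the edge vector stays in \<open>P\<close>, where the
  coordinate is still nonnegative.\<close>

lemma interior_coord_pos:
  assumes v: "v \<in> vertices P" and u: "u \<in> interior P"
  shows "0 < coord (w v) (u - v) k"
proof -
  note f = frame[OF v]
  have w0: "w v k \<noteq> 0" using coord_frame[OF f, of k k] coord_simps(4)[OF f, of k] by auto
  obtain r where r: "r > 0" "ball u r \<subseteq> P" using u by (auto simp: mem_interior)
  define c where "c = r / (2 * norm (w v k))"
  have c: "c > 0" using r w0 by (simp add: c_def)
  have "u - c *\<^sub>R w v k \<in> ball u r" using r w0 by (simp add: dist_norm c_def)
  then have "0 \<le> coord (w v) (u - c *\<^sub>R w v k - v) k" using r coord_nonneg[OF v] by blast
  also have "\<dots> = coord (w v) (u - v) k - c"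
    by (simp add: coord_simps[OF f] coord_frame[OF f])
  finally show ?thesis using c by simp
qed

lemma near_vertex_interior:
  assumes v: "v \<in> vertices P"
  obtains \<delta> where "\<delta> > 0" "\<And>x. (\<And>k. 0 < coord (w v) (x - v) k) \<Longrightarrow>
    (\<And>k. coord (w v) (x - v) k < \<delta>) \<Longrightarrow> x \<in> interior P"
    "\<And>x. (\<And>k. 0 \<le> coord (w v) (x - v) k) \<Longrightarrow>
    (\<And>k. coord (w v) (x - v) k \<le> \<delta>) \<Longrightarrow> x \<in> P"
proof -
  obtain \<delta> where \<delta>: "\<delta> > 0" and near: "\<And>x. (\<And>k. 0 \<le> coord (w v) (x - v) k) \<Longrightarrow>
    (\<And>k. coord (w v) (x - v) k \<le> \<delta>) \<Longrightarrow> x \<in> P" using near_vertex[OF v] by metis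
  let ?O = "{x. \<forall>k. 0 < coord (w v) (x - v) k \<and> coord (w v) (x - v) k < \<delta>}"
  have "open ?O"
    unfolding Collect_all_eq
    by (intro open_INT finite_UNIV ballI open_Collect_conj open_Collect_less continuous_on_const
        continuous_on_coord[OF frame[OF v]]) simp
  moreover have "?O \<subseteq> P" using near by (auto intro: less_imp_le)
  ultimately have "?O \<subseteq> interior P" by (rule interior_maximal[rotated])
  then show ?thesis using that[OF \<delta> _ near] by blast
qed

text \<open>Outside K the coordinates of y vanish, so those of y + \<epsilon> (y - x) are
  -\<epsilon> times those of x; in the interior they must be positive. Inside K nothing is required
  of x, since y can be taken with positive coordinates there. Thus a condition that mentions no
  vertex is read off in coordinates at any vertex of the face.\<close>

lemma beyond_vface:
  assumes v: "v \<in> vertices P"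
  shows "beyond (vface v K) x \<longleftrightarrow> (\<forall>k. k \<notin> K \<longrightarrow> coord (w v) (x - v) k < 0)"
proof
  note f = frame[OF v]
  assume "beyond (vface v K) x"
  then obtain y \<epsilon> where y: "y \<in> vface v K" "\<epsilon> > 0" "y + \<epsilon> *\<^sub>R (y - x) \<in> interior P"
    by (auto simp: beyond_def)
  show "\<forall>k. k \<notin> K \<longrightarrow> coord (w v) (x - v) k < 0"
  proof (intro allI impI)
    fix k assume "k \<notin> K"
    then have yk: "coord (w v) (y - v) k = 0" using y by (simp add: vface_def)
    have "0 < coord (w v) (y + \<epsilon> *\<^sub>R (y - x) - v) k" by (rule interior_coord_pos[OF v y(3)])
    also have "y + \<epsilon> *\<^sub>R (y - x) - v = (1 + \<epsilon>) *\<^sub>R (y - v) - \<epsilon> *\<^sub>R (x - v)"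
      by (simp add: algebra_simps)
    also have "coord (w v) \<dots> k = - \<epsilon> * coord (w v) (x - v) k"
      by (simp only: coord_simps(2)[OF f, of "(1 + \<epsilon>) *\<^sub>R (y - v)"] coord_simps(3)[OF f] yk)
    finally show "coord (w v) (x - v) k < 0" using y(2) by (simp add: mult_less_0_iff)
  qed
next
  note f = frame[OF v]
  assume neg: "\<forall>k. k \<notin> K \<longrightarrow> coord (w v) (x - v) k < 0"
  define l where "l = coord (w v) (x - v)"
  obtain \<delta> where \<delta>: "\<delta> > 0" and int: "\<And>x. (\<And>k. 0 < coord (w v) (x - v) k) \<Longrightarrow>
    (\<And>k. coord (w v) (x - v) k < \<delta>) \<Longrightarrow> x \<in> interior P" and near: "\<And>x. (\<And>k. 0 \<le> coord (w v) (x - v) k) \<Longrightarrow>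
    (\<And>k. coord (w v) (x - v) k \<le> \<delta>) \<Longrightarrow> x \<in> P" using near_vertex_interior[OF v] by metis
  define M where "M = (\<Sum>k\<in>UNIV. \<bar>l k\<bar>)"
  have lM: "\<bar>l k\<bar> \<le> M" for k unfolding M_def by (rule member_le_sum) auto
  have M: "M \<ge> 0" unfolding M_def by (simp add: sum_nonneg)
  \<comment> \<open>Makes \<epsilon> (\<delta> + M) equal to \<delta>/4: coordinates starting at
    \<delta>/2 stay strictly between 0 and \<delta>, and those starting at 0 stay below
    \<delta>.\<close>
  define \<epsilon> where "\<epsilon> = \<delta> / (4 * (\<delta> + M))"
  have \<epsilon>: "\<epsilon> > 0" using \<delta> M by (simp add: \<epsilon>_def)
  have e1: "\<epsilon> * (\<delta> + M) = \<delta> / 4"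
  proof -
    have "\<delta> + M \<noteq> 0" using \<delta> M by simp
    then show ?thesis by (simp add: \<epsilon>_def divide_simps)
  qed
  then have eM: "\<epsilon> * \<delta> + \<epsilon> * M = \<delta> / 4" by (simp add: algebra_simps)
  have el: "\<bar>\<epsilon> * l k\<bar> \<le> \<epsilon> * M" for k using \<epsilon> lM by (simp add: abs_mult)
  have ed: "\<epsilon> * \<delta> > 0" "\<epsilon> * M \<ge> 0" using \<epsilon> \<delta> M by auto
  define y where "y = v + (\<Sum>k\<in>UNIV. (if k \<in> K then \<delta> / 2 else 0) *\<^sub>R w v k)"
  have cy: "coord (w v) (y - v) k = (if k \<in> K then \<delta> / 2 else 0)" for k
    unfolding y_def add_diff_cancel_left' by (rule coord_sum[OF f])
  have "y \<in> P" by (rule near) (use \<delta> in \<open>auto simp: cy\<close>)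
  then have yG: "y \<in> vface v K" by (simp add: vface_def cy)
  have "y + \<epsilon> *\<^sub>R (y - x) - v = (1 + \<epsilon>) *\<^sub>R (y - v) - \<epsilon> *\<^sub>R (x - v)"
    by (simp add: algebra_simps)
  then have c: "coord (w v) (y + \<epsilon> *\<^sub>R (y - x) - v) k = (1 + \<epsilon>) * coord (w v) (y - v) k - \<epsilon> * l k" for k
    by (simp only: coord_simps(2,3)[OF f] l_def)
  have b: "0 < coord (w v) (y + \<epsilon> *\<^sub>R (y - x) - v) k \<and> coord (w v) (y + \<epsilon> *\<^sub>R (y - x) - v) k < \<delta>" for k
  proof (cases "k \<in> K")
    case True
    then have "coord (w v) (y + \<epsilon> *\<^sub>R (y - x) - v) k = \<delta> / 2 + \<epsilon> * \<delta> / 2 - \<epsilon> * l k"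
      unfolding c cy by (simp add: algebra_simps)
    then show ?thesis using el[of k] eM ed \<delta> by linarith
  next
    case False
    then have "coord (w v) (y + \<epsilon> *\<^sub>R (y - x) - v) k = - (\<epsilon> * l k)"
      unfolding c cy by simp
    moreover have "\<epsilon> * l k < 0" using neg False \<epsilon> by (simp add: l_def mult_pos_neg)
    ultimately show ?thesis using el[of k] eM ed \<delta> by linarith
  qed
  have "y + \<epsilon> *\<^sub>R (y - x) \<in> interior P" by (rule int) (use b in auto)
  then show "beyond (vface v K) x" using yG \<epsilon> unfolding beyond_def by blast
qed

section \<open>Generic directions and minimal vertices of faces\<close>

definition generic_dir :: "real ^ 'n \<Rightarrow> bool" where
  "generic_dir \<xi> \<longleftrightarrow> (\<forall>v\<in>vertices P. \<forall>k. w v k \<bullet> \<xi> \<noteq> 0)"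

definition pos :: "real ^ 'n \<Rightarrow> real ^ 'n \<Rightarrow> 'n set" where
  "pos \<xi> v = {k. w v k \<bullet> \<xi> > 0}"

lemma generic_dir_dense:
  assumes "r > 0"
  shows "\<exists>\<eta>\<in>ball \<xi> r. generic_dir \<eta>"
proof -
  let ?W = "\<Union>v\<in>vertices P. range (w v)"
  have "w v k \<noteq> 0" if "v \<in> vertices P" for v k
    using coord_frame[OF frame[OF that], of k k] coord_simps(4)[OF frame[OF that], of k] by auto
  then have "0 \<notin> ?W" by (auto simp: image_iff)
  then show ?thesis
    using avoid_hyperplanes[of ?W r \<xi>] finite_vertices assms by (auto simp: generic_dir_def)
qed

lemma inner_decomp:
  assumes "v \<in> vertices P"
  shows "x \<bullet> \<xi> = v \<bullet> \<xi> + (\<Sum>k\<in>UNIV. coord (w v) (x - v) k * (w v k \<bullet> \<xi>))"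
proof -
  have "(x - v) \<bullet> \<xi> = (\<Sum>k\<in>UNIV. coord (w v) (x - v) k *\<^sub>R w v k) \<bullet> \<xi>"
    by (simp add: sum_coord[OF frame[OF assms]])
  then show ?thesis by (simp add: inner_diff_left inner_sum_left)
qed

lemma vface_min:
  assumes v: "v \<in> vertices P" and K: "K \<subseteq> pos \<xi> v" and x: "x \<in> vface v K" "x \<noteq> v"
  shows "v \<bullet> \<xi> < x \<bullet> \<xi>"
proof -
  note f = frame[OF v]
  have nn: "0 \<le> coord (w v) (x - v) k * (w v k \<bullet> \<xi>)" for k
  proof (cases "k \<in> K")
    case True
    then show ?thesis using K coord_nonneg[OF v, of x k] x by (auto simp: pos_def vface_def)
  next
    case False then show ?thesis using x by (simp add: vface_def)
  qed
  have "\<exists>k. coord (w v) (x - v) k \<noteq> 0"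
  proof (rule ccontr)
    assume "\<nexists>k. coord (w v) (x - v) k \<noteq> 0"
    then have "x - v = 0" using sum_coord[OF f, of "x - v"] by simp
    then show False using x by simp
  qed
  then obtain k where k: "coord (w v) (x - v) k \<noteq> 0" by blast
  then have "k \<in> K" using x by (auto simp: vface_def)
  moreover have "0 \<le> coord (w v) (x - v) k" using coord_nonneg[OF v] x by (simp add: vface_def)
  ultimately have "0 < coord (w v) (x - v) k * (w v k \<bullet> \<xi>)"
    using k K by (auto simp: pos_def)
  then have "0 < (\<Sum>k\<in>UNIV. coord (w v) (x - v) k * (w v k \<bullet> \<xi>))"
    using nn by (intro sum_pos2[of _ k]) auto
  then show ?thesis using inner_decomp[OF v, of x \<xi>] by simp
qed

lemma face_has_min:
  assumes \<xi>: "generic_dir \<xi>" and G: "G face_of P" "G \<noteq> {}"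
  obtains v where "v \<in> vertices P" "v \<in> G" "dirs G v \<subseteq> pos \<xi> v"
proof -
  let ?W = "{u. u extreme_point_of G}"
  have cG: "compact G" "convex G"
    using G convexP compactP face_of_imp_compact face_of_imp_convex by blast+
  have hull: "G = convex hull ?W" by (rule Krein_Milman_Minkowski[OF cG])
  have W: "?W = vertices P \<inter> G" using extreme_point_of_face[OF G(1)] by (auto simp: vertices_def)
  then have fin: "finite ?W" using finite_vertices by simp
  have "?W \<noteq> {}" using hull G(2) by (metis convex_hull_empty)
  then obtain v where v: "v \<in> ?W" and min: "\<And>u. u \<in> ?W \<Longrightarrow> v \<bullet> \<xi> \<le> u \<bullet> \<xi>"
    using ex_min_if_finite[of "(\<lambda>u. u \<bullet> \<xi>) ` ?W"] fin by (auto simp: not_less)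
  have minG: "v \<bullet> \<xi> \<le> x \<bullet> \<xi>" if "x \<in> G" for x
  proof -
    have "G \<subseteq> {x. \<xi> \<bullet> x \<ge> v \<bullet> \<xi>}"
      by (subst hull, rule hull_minimal, use min in \<open>force simp: inner_commute\<close>, rule convex_halfspace_ge)
    then show ?thesis using that by (auto simp: inner_commute)
  qed
  have vV: "v \<in> vertices P" "v \<in> G" using v W by auto
  moreover have "dirs G v \<subseteq> pos \<xi> v"
  proof
    fix k assume "k \<in> dirs G v"
    then obtain s where s: "s > 0" "v + s *\<^sub>R w v k \<in> G" by (auto simp: dirs_def)
    then have "0 \<le> s * (w v k \<bullet> \<xi>)" using minG[OF s(2)] by (simp add: inner_add_left)
    then have "0 \<le> w v k \<bullet> \<xi>" using s by (simp add: zero_le_mult_iff)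
    then show "k \<in> pos \<xi> v" using \<xi> vV by (auto simp: generic_dir_def pos_def order_less_le)
  qed
  ultimately show ?thesis using that by blast
qed

text \<open>Each of the two vertices is the strict \<xi>-minimum of the common face, so distinct
  ones would each lie below the other.\<close>

lemma vface_inj:
  assumes v: "v \<in> vertices P" "K \<subseteq> pos \<xi> v" and v': "v' \<in> vertices P" "K' \<subseteq> pos \<xi> v'"
    and eq: "vface v K = vface v' K'"
  shows "v = v'" "K = K'"
proof -
  show "v = v'"
  proof (rule ccontr)
    assume neq: "v \<noteq> v'"
    have "v \<bullet> \<xi> < v' \<bullet> \<xi>"
      by (rule vface_min[OF v]) (use neq eq vertex_in_vface[OF v'(1)] in auto)
    moreover have "v' \<bullet> \<xi> < v \<bullet> \<xi>"
      by (rule vface_min[OF v']) (use neq eq vertex_in_vface[OF v(1)] in auto)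
    ultimately show False by simp
  qed
  then show "K = K'" using dirs_vface v(1) eq by metis
qed

text \<open>Membership in the tangent cone at v after its \<xi>-descending edges are reversed.
  Reversed coordinates are strictly negative, so these cones are half-open and the decomposition is
  exact also on boundaries.\<close>

definition contributes :: "real ^ 'n \<Rightarrow> real ^ 'n \<Rightarrow> real ^ 'n \<Rightarrow> bool" where
  "contributes \<xi> v x \<longleftrightarrow> (\<forall>k. 0 \<le> coord (w v) (x - v) k \<longleftrightarrow> w v k \<bullet> \<xi> > 0)"

text \<open>The right-hand side does not depend on \<open>\<xi>\<close>: each nonempty face is charged to its unique
  \<open>\<xi>\<close>-minimal vertex.\<close>

lemma sum_contributes:
  assumes \<xi>: "generic_dir \<xi>"
  shows "(\<Sum>v\<in>vertices P. if contributes \<xi> v x then (-1) ^ card (pos \<xi> v) else 0) =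
    (\<Sum>G | G face_of P \<and> G \<noteq> {} \<and> beyond G x. (-1) ^ nat (aff_dim G) :: complex)"
proof -
  let ?N = "\<lambda>v. {k. 0 \<le> coord (w v) (x - v) k}"
  let ?A = "\<lambda>v. {K. ?N v \<subseteq> K \<and> K \<subseteq> pos \<xi> v}"
  let ?S = "SIGMA v:vertices P. ?A v"
  have finA: "finite (?A v)" for v by (rule finite_subset[of _ UNIV]) auto
  \<comment> \<open>A pair (v, K) stands for the face \<open>vface v K\<close>: the upper bound on K
    makes v its minimal vertex, the lower bound says that x is beyond it.\<close>
  have img: "(\<lambda>(v, K). vface v K) ` ?S = {G. G face_of P \<and> G \<noteq> {} \<and> beyond G x}"
  proof (intro set_eqI iffI)
    fix G assume "G \<in> (\<lambda>(v, K). vface v K) ` ?S"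
    then obtain v K where vK: "v \<in> vertices P" "?N v \<subseteq> K" "G = vface v K" by auto
    moreover have "beyond (vface v K) x"
      using vK by (subst beyond_vface) (auto simp: not_le[symmetric])
    ultimately show "G \<in> {G. G face_of P \<and> G \<noteq> {} \<and> beyond G x}"
      using vK vface_face_of[OF vK(1)] vertex_in_vface[OF vK(1)] by blast
  next
    fix G assume "G \<in> {G. G face_of P \<and> G \<noteq> {} \<and> beyond G x}"
    then have G: "G face_of P" "G \<noteq> {}" "beyond G x" by auto
    obtain v where v: "v \<in> vertices P" "v \<in> G" "dirs G v \<subseteq> pos \<xi> v"
      using face_has_min[OF \<xi> G(1,2)] by blast
    have eq: "G = vface v (dirs G v)" by (rule face_eq_vface[OF v(1) G(1) v(2)])
    have "\<forall>k. k \<notin> dirs G v \<longrightarrow> coord (w v) (x - v) k < 0"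
      using G(3) eq beyond_vface[OF v(1)] by metis
    then have "?N v \<subseteq> dirs G v" by (auto simp: not_le[symmetric])
    then have "(v, dirs G v) \<in> ?S" using v by auto
    then show "G \<in> (\<lambda>(v, K). vface v K) ` ?S" using eq by force
  qed
  have inj: "inj_on (\<lambda>(v, K). vface v K) ?S"
  proof (rule inj_onI)
    fix p q assume p: "p \<in> ?S" and q: "q \<in> ?S" and eq: "(\<lambda>(v, K). vface v K) p = (\<lambda>(v, K). vface v K) q"
    obtain v K v' K' where pq: "p = (v, K)" "q = (v', K')" by (metis surj_pair)
    show "p = q"
      using vface_inj[of v K \<xi> v' K'] p q eq unfolding pq by auto
  qed
  have "(\<Sum>G | G face_of P \<and> G \<noteq> {} \<and> beyond G x. (-1) ^ nat (aff_dim G) :: complex)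
      = (\<Sum>(v, K)\<in>?S. (-1) ^ nat (aff_dim (vface v K)))"
    unfolding img[symmetric] by (subst sum.reindex[OF inj]) (simp add: case_prod_unfold)
  also have "\<dots> = (\<Sum>(v, K)\<in>?S. (-1) ^ card K)"
    by (rule sum.cong[OF refl]) (auto simp: aff_dim_vface)
  also have "\<dots> = (\<Sum>v\<in>vertices P. \<Sum>K\<in>?A v. (-1) ^ card K)"
    using finite_vertices finA by (simp add: sum.Sigma)
  also have "\<dots> = (\<Sum>v\<in>vertices P. if contributes \<xi> v x then (-1) ^ card (pos \<xi> v) else 0)"
  proof (rule sum.cong[OF refl])
    fix v
    \<comment> \<open>The inner sum over an interval of sets survives only if its ends
      coincide.\<close>
    have "contributes \<xi> v x \<longleftrightarrow> ?N v = pos \<xi> v"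
      by (auto simp: contributes_def pos_def)
    then show "(\<Sum>K\<in>?A v. (-1) ^ card K) = (if contributes \<xi> v x then (-1) ^ card (pos \<xi> v) else (0::complex))"
      using sum_neg_one_between[of "pos \<xi> v" "?N v"] by simp
  qed
  finally show ?thesis by simp
qed

text \<open>On an edge that does not ascend, the coordinate is negative and the inner product at
  most 0, so the flipped cone lies above its apex.\<close>

lemma contributes_min:
  assumes v: "v \<in> vertices P" and c: "contributes \<xi> v x"
  shows "v \<bullet> \<xi> \<le> x \<bullet> \<xi>"
proof -
  have "0 \<le> coord (w v) (x - v) k * (w v k \<bullet> \<xi>)" for k
  proof (cases "w v k \<bullet> \<xi> > 0")
    case True
    then show ?thesis using c by (simp add: contributes_def)
  next
    case False
    then have "coord (w v) (x - v) k < 0" using c by (simp add: contributes_def not_le[symmetric])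
    then show ?thesis using False by (intro mult_nonpos_nonpos) auto
  qed
  then have "0 \<le> (\<Sum>k\<in>UNIV. coord (w v) (x - v) k * (w v k \<bullet> \<xi>))" by (intro sum_nonneg)
  then show ?thesis using inner_decomp[OF v, of x \<xi>] by simp
qed

text \<open>For \<open>x\<close> outside \<open>P\<close> the sum is computed with another
  direction, one separating \<open>x\<close> from \<open>P\<close>, for which all its terms vanish.\<close>

theorem Lawrence_Varchenko:
  assumes \<xi>: "generic_dir \<xi>"
  shows "(\<Sum>v\<in>vertices P. if contributes \<xi> v x then (-1) ^ card (- pos \<xi> v) else 0)
    = (if x \<in> P then 1 else (0::complex))"
proof (cases "x \<in> P")
  case True
  have P0: "P \<noteq> {}" using True by blast
  have PP: "P face_of P" by (rule face_of_refl[OF convexP])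
  obtain v0 where v0: "v0 \<in> vertices P" "v0 \<in> P" "dirs P v0 \<subseteq> pos \<xi> v0"
    using face_has_min[OF \<xi> PP P0] by blast
  have dP: "dirs P v = UNIV" if "v \<in> vertices P" for v
    using edge_point[OF that] by (auto simp: dirs_def)
  \<comment> \<open>Points of \<open>P\<close> have nonnegative coordinates, so only a vertex with
    all edges ascending contributes. That is the minimal vertex of \<open>P\<close>, and its sign is
    (-1)^0.\<close>
  have iff: "contributes \<xi> v x \<longleftrightarrow> v = v0" if v: "v \<in> vertices P" for v
  proof
    assume "contributes \<xi> v x"
    then have "UNIV \<subseteq> pos \<xi> v" using coord_nonneg[OF v True] by (auto simp: contributes_def pos_def)
    moreover have "vface v UNIV = vface v0 UNIV" by (auto simp: vface_def)
    ultimately show "v = v0" using vface_inj(1)[OF v _ v0(1)] v0(3) dP[OF v0(1)] by metis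
  next
    assume "v = v0"
    then show "contributes \<xi> v x"
      using v0 dP coord_nonneg[OF v0(1) True] by (auto simp: contributes_def pos_def)
  qed
  have "(\<Sum>v\<in>vertices P. if contributes \<xi> v x then (-1) ^ card (- pos \<xi> v) else (0::complex))
      = (\<Sum>v\<in>vertices P. if v = v0 then (-1) ^ card (- pos \<xi> v) else 0)"
    by (rule sum.cong[OF refl]) (simp add: iff)
  also have "\<dots> = (-1) ^ card (- pos \<xi> v0)" using v0 finite_vertices by simp
  also have "- pos \<xi> v0 = {}" using v0 dP by auto
  finally show ?thesis using True by simp
next
  case False
  obtain a b where ab: "a \<bullet> x < b" "\<forall>y\<in>P. a \<bullet> y > b"
    using separating_hyperplane_closed_point[OF convexP compact_imp_closed[OF compactP] False] by auto
  obtain B where B: "B > 0" "\<And>y. y \<in> insert x P \<Longrightarrow> norm y \<le> B"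
    using compact_imp_bounded[OF compactP] by (metis bounded_insert bounded_pos)
  \<comment> \<open>The norm of v - x is at most 2 B, so moving a by less than r changes the inner
    product with v - x by at most b - a \<bullet> x. The generic direction \<eta> therefore still
    separates x from the vertices.\<close>
  define r where "r = (b - a \<bullet> x) / (2 * B)"
  have r: "r > 0" using ab B by (simp add: r_def)
  obtain \<eta> where \<eta>: "\<eta> \<in> ball a r" "generic_dir \<eta>" using generic_dir_dense[OF r] by blast
  have no: "\<not> contributes \<eta> v x" if v: "v \<in> vertices P" for v
  proof
    assume "contributes \<eta> v x"
    then have "v \<bullet> \<eta> \<le> x \<bullet> \<eta>" by (rule contributes_min[OF v])
    then have "v \<bullet> a - x \<bullet> a \<le> (v - x) \<bullet> (a - \<eta>)" by (simp add: algebra_simps)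
    also have "\<dots> \<le> norm (v - x) * norm (a - \<eta>)" by (rule norm_cauchy_schwarz)
    also have "\<dots> \<le> (2 * B) * r"
    proof (intro mult_mono)
      show "norm (v - x) \<le> 2 * B"
        using norm_triangle_ineq4[of v x] B(2)[of v] B(2)[of x] vertex_in[OF v] by simp
      show "norm (a - \<eta>) \<le> r" using \<eta> by (simp add: dist_norm)
    qed (use B in auto)
    also have "\<dots> = b - a \<bullet> x" using B by (simp add: r_def)
    finally have "a \<bullet> v \<le> b" by (simp add: inner_commute)
    then show False using ab vertex_in[OF v] by fastforce
  qed
  \<comment> \<open>The face sum counts ascending edges, the theorem counts the others. The two
    signs differ by (-1)^d, which depends neither on the vertex nor on the direction, so the change
    of direction remains possible.\<close>
  have sgn: "(-1) ^ card (- pos \<zeta> v) = (-1) ^ CARD('n) * ((-1) ^ card (pos \<zeta> v) :: complex)" for \<zeta> v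
  proof -
    have "card (- pos \<zeta> v) + card (pos \<zeta> v) = CARD('n)"
      by (simp add: Compl_eq_Diff_UNIV card_Diff_subset card_mono)
    then have "(-1) ^ CARD('n) * ((-1) ^ card (pos \<zeta> v) :: complex)
        = (-1) ^ card (- pos \<zeta> v) * ((-1) ^ card (pos \<zeta> v) * (-1) ^ card (pos \<zeta> v))"
      by (metis power_add mult.assoc)
    also have "(-1) ^ card (pos \<zeta> v) * (-1) ^ card (pos \<zeta> v) = (1::complex)"
      by (simp flip: power_mult_distrib)
    finally show ?thesis by simp
  qed
  have "(\<Sum>v\<in>vertices P. if contributes \<xi> v x then (-1) ^ card (- pos \<xi> v) else (0::complex))
      = (-1) ^ CARD('n) * (\<Sum>v\<in>vertices P. if contributes \<xi> v x then (-1) ^ card (pos \<xi> v) else 0)"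
    by (simp add: sgn sum_distrib_left if_distrib cong: if_cong)
  also have "\<dots> = (-1) ^ CARD('n) * (\<Sum>v\<in>vertices P. if contributes \<eta> v x then (-1) ^ card (pos \<eta> v) else 0)"
    by (simp add: sum_contributes[OF \<xi>] sum_contributes[OF \<eta>(2)])
  also have "\<dots> = 0" using no by simp
  finally show ?thesis using False by simp
qed

end

section \<open>Brion's formula\<close>

lemma pairing_add: "pairing (x + y) z = pairing x z + pairing y z"
  by (simp add: pairing_def sum.distrib algebra_simps)

lemma pairing_scaleR: "pairing (r *\<^sub>R x) z = of_real r * pairing x z"
  by (simp add: pairing_def sum_distrib_left algebra_simps)

lemma pairing_0: "pairing 0 z = 0"
  by (simp add: pairing_def)

lemma pairing_sum: "pairing (\<Sum>k\<in>A. f k) z = (\<Sum>k\<in>A. pairing (f k) z)"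
  by (induction A rule: infinite_finite_induct) (auto simp: pairing_add pairing_0)

lemma pairing_scale_right: "pairing x (\<chi> m. c * z $ m) = c * pairing x z"
  by (simp add: pairing_def sum_distrib_left algebra_simps)

lemma pairing_shift:
  "pairing x (\<chi> m. z $ m + s * complex_of_real (\<xi> $ m)) = pairing x z + s * of_real (x \<bullet> \<xi>)"
  by (simp add: pairing_def inner_vec_def sum.distrib sum_distrib_left algebra_simps)

section \<open>Lattice points and the half-open parallelepiped\<close>

lemma int_lattice_add: "x \<in> int_lattice \<Longrightarrow> y \<in> int_lattice \<Longrightarrow> x + y \<in> int_lattice"
  by (simp add: int_lattice_def)

lemma int_lattice_scale_int: "x \<in> int_lattice \<Longrightarrow> of_int m *\<^sub>R x \<in> int_lattice"
  by (simp add: int_lattice_def)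

lemma int_lattice_sum:
  "(\<And>k. k \<in> A \<Longrightarrow> f k \<in> int_lattice) \<Longrightarrow> (\<Sum>k\<in>A. f k) \<in> int_lattice"
  by (induction A rule: infinite_finite_induct) (auto simp: int_lattice_add, auto simp: int_lattice_def)

lemma primitive_vector_int_lattice: "primitive_vector u \<Longrightarrow> u \<in> int_lattice"
  by (auto simp: primitive_vector_def int_lattice_def)

lemma finite_bounded_int_lattice:
  fixes B :: "(real ^ 'n) set"
  assumes "bounded B"
  shows "finite (B \<inter> int_lattice)"
proof -
  obtain N where N: "\<And>x. x \<in> B \<Longrightarrow> norm x \<le> N" using assms by (auto simp: bounded_iff)
  let ?F = "{f. \<forall>i::'n. f i \<in> {-\<lceil>N\<rceil>..\<lceil>N\<rceil>}}"
  have "?F = PiE UNIV (\<lambda>_. {-\<lceil>N\<rceil>..\<lceil>N\<rceil>})" by auto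
  then have fin: "finite ?F" by (simp add: finite_PiE)
  have "x \<in> (\<lambda>f. \<chi> i. of_int (f i)) ` ?F" if x: "x \<in> B" "x \<in> int_lattice" for x
  proof -
    have "\<forall>i. \<exists>m. x $ i = of_int m" using x(2) by (auto simp: int_lattice_def elim: Ints_cases)
    then obtain f where f: "\<And>i. x $ i = of_int (f i)" by metis
    have "\<bar>x $ i\<bar> \<le> N" for i using component_le_norm_cart[of x i] N[OF x(1)] by simp
    then have "\<bar>real_of_int (f i)\<bar> \<le> N" for i using f by simp
    then have "f i \<in> {-\<lceil>N\<rceil>..\<lceil>N\<rceil>}" for i
      using abs_le_D1 abs_le_D2 by (metis abs_le_iff atLeastAtMost_iff le_ceiling_iff of_int_abs of_int_le_iff le_of_int_ceiling minus_le_iff order_trans)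
    then show ?thesis using f by (auto intro!: image_eqI[of _ _ f] simp: vec_eq_iff)
  qed
  then have "B \<inter> int_lattice \<subseteq> (\<lambda>f. \<chi> i. of_int (f i)) ` ?F" by blast
  then show ?thesis using fin finite_surj by blast
qed

lemma bounded_half_open_pped: "bounded (half_open_pped b)"
proof -
  have "norm x \<le> (\<Sum>k\<in>UNIV. norm (b k))" if x: "x \<in> half_open_pped b" for x
  proof -
    obtain c where c: "x = (\<Sum>k\<in>UNIV. c k *\<^sub>R b k)" "\<forall>k. 0 \<le> c k \<and> c k < 1"
      using x by (auto simp: half_open_pped_def)
    have "norm x \<le> (\<Sum>k\<in>UNIV. norm (c k *\<^sub>R b k))" unfolding c(1) by (rule norm_sum)
    also have "\<dots> \<le> (\<Sum>k\<in>UNIV. norm (b k))"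
      using c(2) by (intro sum_mono) (auto simp: mult_left_le_one_le less_imp_le)
    finally show ?thesis .
  qed
  then show ?thesis by (auto simp: bounded_iff)
qed

lemma finite_pped_points: "finite (pped_points b y)"
proof -
  have "bounded ((\<lambda>x. y + x) ` half_open_pped b)"
    by (intro bounded_translation bounded_half_open_pped)
  then have "finite ((\<lambda>x. y + x) ` half_open_pped b \<inter> int_lattice)"
    by (rule finite_bounded_int_lattice)
  then have "finite ((\<lambda>q. q - y) ` ((\<lambda>x. y + x) ` half_open_pped b \<inter> int_lattice))" by simp
  moreover have "pped_points b y \<subseteq> (\<lambda>q. q - y) ` ((\<lambda>x. y + x) ` half_open_pped b \<inter> int_lattice)"
  proof
    fix p assume "p \<in> pped_points b y"
    then obtain q where q: "q \<in> int_lattice" "p = q - y" "p \<in> half_open_pped b"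
      by (auto simp: pped_points_def)
    then have "q = y + p" by simp
    then show "p \<in> (\<lambda>q. q - y) ` ((\<lambda>x. y + x) ` half_open_pped b \<inter> int_lattice)"
      using q by blast
  qed
  ultimately show ?thesis by (rule finite_subset[rotated])
qed

lemma half_open_pped_iff:
  assumes "is_frame b"
  shows "p \<in> half_open_pped b \<longleftrightarrow> (\<forall>k. 0 \<le> coord b p k \<and> coord b p k < 1)"
proof
  assume "p \<in> half_open_pped b"
  then show "\<forall>k. 0 \<le> coord b p k \<and> coord b p k < 1"
    by (auto simp: half_open_pped_def coord_sum[OF assms])
next
  assume "\<forall>k. 0 \<le> coord b p k \<and> coord b p k < 1"
  then show "p \<in> half_open_pped b"
    using sum_coord[OF assms, of p, symmetric] unfolding half_open_pped_def by blast
qed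

section \<open>Exponential sums over half-lines, orthants and cones\<close>

lemma geometric_has_sum:
  fixes x :: complex
  assumes "norm x < 1"
  shows "((\<lambda>n. x ^ n) has_sum 1 / (1 - x)) UNIV" "(\<lambda>n. norm (x ^ n)) summable_on UNIV"
  using assms
  by (auto intro!: norm_summable_imp_has_sum geometric_sums summable_geometric
      simp: norm_power summable_on_UNIV_nonneg_real_iff)

text \<open>The possible floors of a nonnegative and of a negative coordinate; starting the second
  range at -1 makes the two partition the integers.\<close>

definition half_line :: "bool \<Rightarrow> int set" where
  "half_line s = (if s then {0..} else {..-1})"

text \<open>The two complementary half-lines converge on opposite half-planes of a, but to the same
  function up to sign. Hence flipping an edge changes a cone's closed form only by a sign.\<close>

lemma exp_half_line_has_sum:
  fixes a :: complex
  assumes "if s then Re a < 0 else Re a > 0"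
  shows "((\<lambda>n. exp (of_int n * a)) has_sum (if s then 1 else -1) / (1 - exp a)) (half_line s)"
    "(\<lambda>n. norm (exp (of_int n * a))) summable_on half_line s"
proof -
  show "((\<lambda>n. exp (of_int n * a)) has_sum (if s then 1 else -1) / (1 - exp a)) (half_line s)"
  proof (cases s)
    case True
    have bij: "bij_betw int UNIV (half_line s)"
      using True by (auto simp: half_line_def bij_betw_def image_iff intro: inj_of_nat)
         (metis nonneg_int_cases)
    have "((\<lambda>n. exp a ^ n) has_sum 1 / (1 - exp a)) UNIV"
      by (rule geometric_has_sum) (use assms True in simp)
    then have "((\<lambda>n. exp (of_int (int n) * a)) has_sum 1 / (1 - exp a)) UNIV"
      by (simp add: exp_of_nat_mult)
    then show ?thesis
      using has_sum_reindex_bij_betw[OF bij, of "\<lambda>n. exp (of_int n * a)"] True by simp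
  next
    case False
    \<comment> \<open>The offset 1 puts a factor exp (-a) in front of the geometric series, which
      turns 1 / (1 - exp (-a)) into -1 / (1 - exp a).\<close>
    have bij: "bij_betw (\<lambda>n. - int n - 1) UNIV (half_line s)"
      by (rule bij_betwI[of _ _ _ "\<lambda>m. nat (- m - 1)"]) (use False in \<open>auto simp: half_line_def\<close>)
    have "((\<lambda>n. exp (-a) * exp (-a) ^ n) has_sum exp (-a) * (1 / (1 - exp (-a)))) UNIV"
      by (intro has_sum_cmult_right geometric_has_sum) (use assms False in simp)
    moreover have "exp (-a) * exp (-a) ^ n = exp (of_int (- int n - 1) * a)" for n
    proof -
      have "exp (-a) ^ n = exp (of_nat n * (-a))" by (rule exp_of_nat_mult[symmetric])
      moreover have "of_int (- int n - 1) * a = -a + of_nat n * (-a)" by (simp add: algebra_simps)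
      ultimately show ?thesis by (simp only: exp_add)
    qed
    moreover have "exp (-a) * (1 / (1 - exp (-a))) = -1 / (1 - exp a)"
    proof -
      have "norm (exp a) \<noteq> 1" using assms False by simp
      then have "exp a \<noteq> 1" by (metis norm_one)
      then show ?thesis by (simp add: exp_minus field_simps)
    qed
    ultimately show ?thesis
      using has_sum_reindex_bij_betw[OF bij, of "\<lambda>n. exp (of_int n * a)"] False by simp
  qed
  then have "(\<lambda>n. exp (of_int n * a)) summable_on half_line s" by (rule has_sum_imp_summable)
  then show "(\<lambda>n. norm (exp (of_int n * a))) summable_on half_line s"
    by (simp only: summable_on_iff_abs_summable_on_complex)
qed

text \<open>Absolute summability lets the sum factor over the coordinates; each flipped coordinate
  contributes one sign.\<close>

lemma exp_orthant_has_sum: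
  fixes a :: "'n::finite \<Rightarrow> complex"
  assumes "\<And>k. if k \<in> \<sigma> then Re (a k) < 0 else Re (a k) > 0"
  shows "((\<lambda>n. \<Prod>k\<in>UNIV. exp (of_int (n k) * a k)) has_sum
     (-1) ^ card (- \<sigma>) / (\<Prod>k\<in>UNIV. 1 - exp (a k))) (PiE UNIV (\<lambda>k. half_line (k \<in> \<sigma>)))"
proof -
  note hs = exp_half_line_has_sum[of "k \<in> \<sigma>" "a k" for k, OF assms]
  let ?f = "\<lambda>n. \<Prod>k\<in>UNIV. exp (of_int (n k) * a k)"
  let ?N = "PiE UNIV (\<lambda>k. half_line (k \<in> \<sigma>))"
  have "Infinite_Set_Sum.abs_summable_on ?f ?N"
    by (rule abs_summable_on_prod_PiE[where f = "\<lambda>k n. exp (of_int n * a k)"])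
       (use hs(2) in \<open>auto simp: abs_summable_equivalent[symmetric]\<close>)
  then have "?f summable_on ?N"
    by (simp add: abs_summable_equivalent[symmetric] abs_summable_summable)
  then have "(?f has_sum infsum ?f ?N) ?N" by (rule has_sum_infsum)
  also have "infsum ?f ?N = (\<Prod>k\<in>UNIV. infsum (\<lambda>n. exp (of_int n * a k)) (half_line (k \<in> \<sigma>)))"
    by (rule infsum_prod_PiE_abs) (use hs(2) in auto)
  also have "\<dots> = (\<Prod>k\<in>UNIV. (if k \<in> \<sigma> then 1 else -1) / (1 - exp (a k)))"
    using hs(1) by (intro prod.cong refl infsumI)
  also have "\<dots> = (\<Prod>k\<in>UNIV. (if k \<in> \<sigma> then 1 else -1)) / (\<Prod>k\<in>UNIV. 1 - exp (a k))"
    by (simp add: prod_dividef)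
  also have "(\<Prod>k\<in>UNIV. (if k \<in> \<sigma> then 1 else -1 :: complex)) = (-1) ^ card (- \<sigma>)"
    by (subst prod.If_cases) (auto simp: Compl_eq)
  finally show ?thesis .
qed

text \<open>Every lattice point is uniquely \<open>y + p + \<Sum>\<^sub>k n\<^sub>k b\<^sub>k\<close> with \<open>p\<close> in the parallelepiped and
  \<open>n\<^sub>k\<close> the floor of its \<open>k\<close>-th coordinate. A coordinate is negative iff \<open>n\<^sub>k \<le> -1\<close>, so flipping
  a cone changes the range of \<open>n\<close> but not the parallelepiped.\<close>

lemma exp_cone_has_sum:
  fixes b :: "'n::finite \<Rightarrow> real ^ 'n"
  assumes b: "is_frame b" and int: "\<And>k. b k \<in> int_lattice"
    and sgn: "\<And>k. if k \<in> \<sigma> then Re (pairing (b k) z) < 0 else Re (pairing (b k) z) > 0"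
  shows "((\<lambda>q. exp (pairing q z)) has_sum
     (-1) ^ card (- \<sigma>) * (exp (pairing y z) * (\<Sum>p\<in>pped_points b y. exp (pairing p z)) /
        (\<Prod>k\<in>UNIV. 1 - exp (pairing (b k) z))))
     {q \<in> int_lattice. \<forall>k. 0 \<le> coord b (q - y) k \<longleftrightarrow> k \<in> \<sigma>}"
proof -
  let ?N = "PiE UNIV (\<lambda>k. half_line (k \<in> \<sigma>))"
  let ?C = "{q \<in> int_lattice. \<forall>k. 0 \<le> coord b (q - y) k \<longleftrightarrow> k \<in> \<sigma>}"
  let ?D = "\<Prod>k\<in>UNIV. 1 - exp (pairing (b k) z)"
  define g where "g p n = y + p + (\<Sum>k\<in>UNIV. of_int (n k) *\<^sub>R b k)" for p and n :: "'n \<Rightarrow> int"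
  have cg: "coord b (g p n - y) k = coord b p k + of_int (n k)" for p n k
  proof -
    have "g p n - y = p + (\<Sum>k\<in>UNIV. of_int (n k) *\<^sub>R b k)" by (simp add: g_def)
    then show ?thesis by (simp add: coord_simps[OF b] coord_sum[OF b])
  qed
  have pc: "0 \<le> coord b p k" "coord b p k < 1" if "p \<in> pped_points b y" for p k
    using that half_open_pped_iff[OF b] by (auto simp: pped_points_def)
  have fl: "n k = \<lfloor>coord b (g p n - y) k\<rfloor>" if "p \<in> pped_points b y" for p n k
    unfolding cg using pc[OF that, of k] by (simp add: floor_unique)
  have inj: "p = p' \<and> n = n'"
    if "p \<in> pped_points b y" "p' \<in> pped_points b y" "g p n = g p' n'" for p p' n n'
  proof -
    have "n = n'" using fl[OF that(1), of n] fl[OF that(2), of n'] that(3) by (intro ext) metis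
    then show ?thesis using that(3) by (simp add: g_def)
  qed
  have piece: "((\<lambda>q. exp (pairing q z)) has_sum
      exp (pairing y z) * exp (pairing p z) * ((-1) ^ card (- \<sigma>) / ?D)) (g p ` ?N)"
    if p: "p \<in> pped_points b y" for p
  proof -
    have bij: "bij_betw (g p) ?N (g p ` ?N)"
      using inj[OF p p] by (auto simp: bij_betw_def inj_on_def)
    have "exp (pairing (g p n) z)
        = exp (pairing y z) * exp (pairing p z) * (\<Prod>k\<in>UNIV. exp (of_int (n k) * pairing (b k) z))" for n
      by (simp add: g_def pairing_add pairing_sum pairing_scaleR exp_add exp_sum)
    moreover have "((\<lambda>n. exp (pairing y z) * exp (pairing p z) * (\<Prod>k\<in>UNIV. exp (of_int (n k) * pairing (b k) z)))
       has_sum exp (pairing y z) * exp (pairing p z) * ((-1) ^ card (- \<sigma>) / ?D)) ?N"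
      by (intro has_sum_cmult_right exp_orthant_has_sum sgn)
    ultimately show ?thesis
      using has_sum_reindex_bij_betw[OF bij, of "\<lambda>q. exp (pairing q z)"] by simp
  qed
  have "((\<lambda>q. exp (pairing q z)) has_sum
     (\<Sum>p\<in>pped_points b y. exp (pairing y z) * exp (pairing p z) * ((-1) ^ card (- \<sigma>) / ?D)))
     (\<Union>p\<in>pped_points b y. g p ` ?N)"
    by (rule sum_has_sum[OF finite_pped_points piece]) (use inj in blast)+
  also have "(\<Union>p\<in>pped_points b y. g p ` ?N) = ?C"
  proof (intro set_eqI iffI)
    fix q assume "q \<in> (\<Union>p\<in>pped_points b y. g p ` ?N)"
    then obtain p n where p: "p \<in> pped_points b y" and n: "n \<in> ?N" and q: "q = g p n" by blast
    obtain q0 where q0: "q0 \<in> int_lattice" "p = q0 - y" using p by (auto simp: pped_points_def)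
    have "q = q0 + (\<Sum>k\<in>UNIV. of_int (n k) *\<^sub>R b k)" by (simp add: q g_def q0)
    then have "q \<in> int_lattice"
      using q0 int by (auto intro!: int_lattice_add int_lattice_sum int_lattice_scale_int)
    moreover have "0 \<le> coord b (q - y) k \<longleftrightarrow> k \<in> \<sigma>" for k
    proof -
      have "n k \<in> half_line (k \<in> \<sigma>)" using n by auto
      then have "0 \<le> n k \<longleftrightarrow> k \<in> \<sigma>" by (auto simp: half_line_def split: if_splits)
      moreover have "0 \<le> coord b (q - y) k \<longleftrightarrow> 0 \<le> n k"
        using fl[OF p, of n k] unfolding q by simp
      ultimately show ?thesis by simp
    qed
    ultimately show "q \<in> ?C" by simp
  next
    fix q assume q: "q \<in> ?C"
    define n where "n k = \<lfloor>coord b (q - y) k\<rfloor>" for k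
    define p where "p = q - y - (\<Sum>k\<in>UNIV. of_int (n k) *\<^sub>R b k)"
    have "coord b p k = frac (coord b (q - y) k)" for k
      unfolding p_def coord_simps(2)[OF b, of "q - y"] coord_sum[OF b] by (simp add: frac_def n_def)
    then have "p \<in> half_open_pped b"
      by (simp add: half_open_pped_iff[OF b] frac_lt_1)
    moreover have "q - (\<Sum>k\<in>UNIV. of_int (n k) *\<^sub>R b k) \<in> int_lattice"
    proof -
      have "q + (\<Sum>k\<in>UNIV. of_int (- n k) *\<^sub>R b k) \<in> int_lattice"
        using q int by (intro int_lattice_add int_lattice_sum int_lattice_scale_int) auto
      then show ?thesis by (simp add: sum_negf)
    qed
    moreover have "p = (q - (\<Sum>k\<in>UNIV. of_int (n k) *\<^sub>R b k)) - y" by (simp add: p_def)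
    ultimately have "p \<in> pped_points b y" unfolding pped_points_def by blast
    moreover have "n \<in> ?N"
    proof (rule PiE_I)
      fix k
      have "0 \<le> n k \<longleftrightarrow> k \<in> \<sigma>" using q by (simp add: n_def)
      then show "n k \<in> half_line (k \<in> \<sigma>)" by (auto simp: half_line_def)
    qed auto
    moreover have "q = g p n" by (simp add: g_def p_def)
    ultimately show "q \<in> (\<Union>p\<in>pped_points b y. g p ` ?N)" by blast
  qed
  also have "(\<Sum>p\<in>pped_points b y. exp (pairing y z) * exp (pairing p z) * ((-1) ^ card (- \<sigma>) / ?D))
    = (-1) ^ card (- \<sigma>) * (exp (pairing y z) * (\<Sum>p\<in>pped_points b y. exp (pairing p z)) / ?D)"
    by (simp add: sum_distrib_left sum_distrib_right sum_divide_distrib mult_ac)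
  finally show ?thesis .
qed

lemma has_sum_sum:
  fixes f :: "'a \<Rightarrow> 'b \<Rightarrow> 'c::topological_comm_monoid_add"
  assumes "\<And>i. i \<in> I \<Longrightarrow> (f i has_sum S i) A"
  shows "((\<lambda>x. \<Sum>i\<in>I. f i x) has_sum (\<Sum>i\<in>I. S i)) A"
  using assms
  by (induction I rule: infinite_finite_induct) (auto intro!: has_sum_add)

context rational_simple_polytope
begin

lemma edge_vector_int: "v \<in> vertices P \<Longrightarrow> w v k \<in> int_lattice"
  using edge_vectors[of v]
  by (auto simp: bij_betw_def primitive_edge_vectors_def intro!: primitive_vector_int_lattice)

text \<open>The closed form of the exponential sum over the unflipped tangent cone at
  \<open>t *\<^sub>R v\<close>, meaningful also where that series diverges.\<close>

definition brion_term :: "real \<Rightarrow> real ^ 'n \<Rightarrow> complex ^ 'n \<Rightarrow> complex" where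
  "brion_term t v z = exp (of_real t * pairing v z) *
     (\<Sum>p\<in>pped_points (w v) (t *\<^sub>R v). exp (pairing p z)) / (\<Prod>k\<in>UNIV. 1 - exp (pairing (w v k) z))"

lemma finite_dilate: "finite ((*\<^sub>R) t ` P \<inter> int_lattice)"
  using compactP compact_imp_bounded bounded_scaling by (intro finite_bounded_int_lattice) blast

text \<open>The sign from summing a flipped cone equals its sign in
  \<open>Lawrence_Varchenko\<close>, so the two cancel and the right-hand side no longer involves
  \<xi>.\<close>

lemma Brion_convergent:
  assumes t: "t > 0" and \<xi>: "generic_dir \<xi>"
    and sgn: "\<And>v k. v \<in> vertices P \<Longrightarrow>
      if w v k \<bullet> \<xi> > 0 then Re (pairing (w v k) z) < 0 else Re (pairing (w v k) z) > 0"
  shows "(\<Sum>q\<in>(*\<^sub>R) t ` P \<inter> int_lattice. exp (pairing q z)) = (\<Sum>v\<in>vertices P. brion_term t v z)"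
proof -
  let ?s = "\<lambda>v. (-1) ^ card (- pos \<xi> v) :: complex"
  let ?f = "\<lambda>v q. if contributes \<xi> v (q /\<^sub>R t) then ?s v * exp (pairing q z) else 0"
  have f: "(?f v has_sum brion_term t v z) int_lattice" if v: "v \<in> vertices P" for v
  proof -
    let ?C = "{q \<in> int_lattice. \<forall>k. 0 \<le> coord (w v) (q - t *\<^sub>R v) k \<longleftrightarrow> k \<in> pos \<xi> v}"
    have "((\<lambda>q. ?s v * exp (pairing q z)) has_sum ?s v * (?s v * brion_term t v z)) ?C"
      unfolding brion_term_def pairing_scaleR[symmetric]
      by (intro has_sum_cmult_right exp_cone_has_sum frame[OF v] edge_vector_int[OF v])
         (use sgn[OF v] in \<open>simp add: pos_def\<close>)
    also have "?s v * (?s v * brion_term t v z) = brion_term t v z"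
      by (simp add: mult.assoc[symmetric] flip: power_mult_distrib)
    finally have *: "((\<lambda>q. ?s v * exp (pairing q z)) has_sum brion_term t v z) ?C" .
    have iff: "contributes \<xi> v (q /\<^sub>R t) \<longleftrightarrow> (\<forall>k. 0 \<le> coord (w v) (q - t *\<^sub>R v) k \<longleftrightarrow> k \<in> pos \<xi> v)" for q
    proof -
      \<comment> \<open>Only signs of coordinates matter, and scaling by 1/t preserves them.\<close>
      have "q /\<^sub>R t - v = (1 / t) *\<^sub>R (q - t *\<^sub>R v)" using t by (simp add: algebra_simps divide_inverse)
      then have "0 \<le> coord (w v) (q /\<^sub>R t - v) k \<longleftrightarrow> 0 \<le> coord (w v) (q - t *\<^sub>R v) k" for k
        using t by (simp add: coord_simps(3)[OF frame[OF v]] zero_le_divide_iff)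
      then show ?thesis by (simp add: contributes_def pos_def)
    qed
    show ?thesis
      by (rule has_sum_cong_neutral[THEN iffD1, OF _ _ _ *]) (auto simp: iff)
  qed
  have "((\<lambda>q. \<Sum>v\<in>vertices P. ?f v q) has_sum (\<Sum>v\<in>vertices P. brion_term t v z)) int_lattice"
    by (rule has_sum_sum) (rule f)
  moreover have "(\<Sum>v\<in>vertices P. ?f v q) = (if q \<in> (*\<^sub>R) t ` P then exp (pairing q z) else 0)" for q
  proof -
    have "(\<Sum>v\<in>vertices P. ?f v q)
        = (\<Sum>v\<in>vertices P. if contributes \<xi> v (q /\<^sub>R t) then ?s v else 0) * exp (pairing q z)"
      unfolding sum_distrib_right by (rule sum.cong) auto
    moreover have "q /\<^sub>R t \<in> P \<longleftrightarrow> q \<in> (*\<^sub>R) t ` P"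
    proof
      assume "q /\<^sub>R t \<in> P"
      moreover have "q = t *\<^sub>R (q /\<^sub>R t)" using t by simp
      ultimately show "q \<in> (*\<^sub>R) t ` P" by blast
    qed (use t in auto)
    ultimately show ?thesis by (simp add: Lawrence_Varchenko[OF \<xi>])
  qed
  ultimately have "((\<lambda>q. if q \<in> (*\<^sub>R) t ` P then exp (pairing q z) else 0) has_sum
      (\<Sum>v\<in>vertices P. brion_term t v z)) int_lattice" by simp
  moreover have "((\<lambda>q. if q \<in> (*\<^sub>R) t ` P then exp (pairing q z) else 0) has_sum
      (\<Sum>q\<in>(*\<^sub>R) t ` P \<inter> int_lattice. exp (pairing q z))) int_lattice"
    by (rule has_sum_cong_neutral[THEN iffD1, OF _ _ _ has_sum_finite[OF finite_dilate[of t]]]) auto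
  ultimately show ?thesis by (rule has_sum_unique[symmetric])
qed

text \<open>Restriction to a complex line makes the continuation a one-variable matter. The
  exceptional parameters s form a closed countable set, whose complement is connected, and s = 0 is
  not among them by the assumption on z.\<close>

lemma Brion:
  assumes t: "t > 0"
    and z: "\<And>v k. v \<in> vertices P \<Longrightarrow> exp (pairing (w v k) z) \<noteq> 1"
  shows "(\<Sum>q\<in>(*\<^sub>R) t ` P \<inter> int_lattice. exp (pairing q z)) = (\<Sum>v\<in>vertices P. brion_term t v z)"
proof -
  obtain \<xi> where \<xi>: "generic_dir \<xi>" using generic_dir_dense[of 1 0] by auto
  define \<zeta> where "\<zeta> s = (\<chi> m. z $ m + s * complex_of_real (\<xi> $ m))" for s
  have p: "pairing x (\<zeta> s) = pairing x z + s * of_real (x \<bullet> \<xi>)" for x s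
    unfolding \<zeta>_def by (rule pairing_shift)
  define L where "L s = (\<Sum>q\<in>(*\<^sub>R) t ` P \<inter> int_lattice. exp (pairing q (\<zeta> s)))" for s
  define R where "R s = (\<Sum>v\<in>vertices P. brion_term t v (\<zeta> s))" for s
  let ?V = "vertices P \<times> (UNIV :: 'n set)"
  let ?bad = "\<Union>(v, k)\<in>?V. {s. exp (pairing (w v k) (\<zeta> s)) = 1}"
  let ?S = "UNIV - ?bad"
  have cnt: "countable ?bad"
  proof (rule countable_UN)
    show "countable ?V" using finite_vertices by (simp add: countable_finite)
    fix vk assume vk: "vk \<in> ?V"
    obtain v k where eq: "vk = (v, k)" by (metis surj_pair)
    \<comment> \<open>The pairing is affine in s with nonzero slope, so each integer m accounts for
      one exceptional s.\<close>
    have "s \<in> range (\<lambda>m. (of_real (2 * of_int m * pi) * \<i> - pairing (w v k) z) / of_real (w v k \<bullet> \<xi>))"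
      if s: "exp (pairing (w v k) (\<zeta> s)) = 1" for s
    proof -
      obtain m :: int where m: "Re (pairing (w v k) (\<zeta> s)) = 0" "Im (pairing (w v k) (\<zeta> s)) = of_int (2 * m) * pi"
        using s unfolding exp_eq_1 by auto
      then have "pairing (w v k) (\<zeta> s) = of_real (2 * of_int m * pi) * \<i>"
        by (simp add: complex_eq_iff)
      moreover have "w v k \<bullet> \<xi> \<noteq> 0" using \<xi> vk eq by (auto simp: generic_dir_def)
      ultimately have "s = (of_real (2 * of_int m * pi) * \<i> - pairing (w v k) z) / of_real (w v k \<bullet> \<xi>)"
        unfolding p by (simp add: field_simps)
      then show ?thesis by (rule range_eqI)
    qed
    then have sub: "{s. exp (pairing (w v k) (\<zeta> s)) = 1} \<subseteq>
      range (\<lambda>m. (of_real (2 * of_int m * pi) * \<i> - pairing (w v k) z) / of_real (w v k \<bullet> \<xi>))"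
      by (intro subsetI) (simp only: mem_Collect_eq)
    show "countable (case vk of (v, k) \<Rightarrow> {s. exp (pairing (w v k) (\<zeta> s)) = 1})"
      unfolding eq prod.case by (rule countable_subset[OF sub]) simp
  qed
  have conn: "connected ?S"
    by (rule connected_open_diff_countable) (use cnt in auto)
  have "closed ?bad"
    using finite_vertices unfolding p
    by (intro closed_UN) (auto intro!: closed_Collect_eq continuous_intros)
  then have op: "open ?S" by (simp add: open_Diff)
  have good: "1 - exp (pairing (w v k) z + s * of_real (w v k \<bullet> \<xi>)) \<noteq> 0"
    if "s \<in> ?S" "v \<in> vertices P" for s v k
    using that unfolding p by auto
  have hol: "(\<lambda>s. L s - R s) holomorphic_on ?S"
    unfolding L_def R_def brion_term_def p
    by (intro holomorphic_intros) (use good in \<open>auto simp: prod_zero_iff\<close>)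
  \<comment> \<open>For Re s < -B the shift outweighs the real part of every pairing of z with an
    edge vector. The added 0 ensures a maximum over a nonempty set.\<close>
  define B where "B = Max ((\<lambda>(v, k). \<bar>Re (pairing (w v k) z)\<bar> / \<bar>w v k \<bullet> \<xi>\<bar>) ` ?V \<union> {0})"
  have finV: "finite ?V" using finite_vertices by simp
  have B: "\<bar>Re (pairing (w v k) z)\<bar> / \<bar>w v k \<bullet> \<xi>\<bar> \<le> B" if "v \<in> vertices P" for v k
    unfolding B_def using that finV by (intro Max_ge) (auto simp: image_iff)
  have sgn: "if w v k \<bullet> \<xi> > 0 then Re (pairing (w v k) (\<zeta> s)) < 0 else Re (pairing (w v k) (\<zeta> s)) > 0"
    if s: "Re s < - B" and v: "v \<in> vertices P" for s v k
  proof -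
    have n0: "w v k \<bullet> \<xi> \<noteq> 0" using \<xi> v by (simp add: generic_dir_def)
    have "\<bar>Re (pairing (w v k) z)\<bar> \<le> B * \<bar>w v k \<bullet> \<xi>\<bar>" using B[OF v, of k] n0 by (simp add: field_simps)
    also have "\<dots> < - Re s * \<bar>w v k \<bullet> \<xi>\<bar>" using s n0 by (intro mult_strict_right_mono) auto
    finally show ?thesis unfolding p using n0 by (cases "w v k \<bullet> \<xi> > 0") (auto simp: abs_if split: if_splits)
  qed
  let ?H = "{s. Re s < - B}"
  have HS: "?H \<subseteq> ?S"
  proof
    fix s assume s: "s \<in> ?H"
    have "exp (pairing (w v k) (\<zeta> s)) \<noteq> 1" if v: "v \<in> vertices P" for v k
    proof
      assume "exp (pairing (w v k) (\<zeta> s)) = 1"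
      then have "Re (pairing (w v k) (\<zeta> s)) = 0" by (simp add: exp_eq_1)
      then show False using sgn[of s v k] s v by (auto split: if_splits)
    qed
    then show "s \<in> ?S" by auto
  qed
  have zero: "L s - R s = 0" if "s \<in> ?H" for s
    unfolding L_def R_def using Brion_convergent[OF t \<xi>, of "\<zeta> s"] sgn[of s] that by simp
  have Hopen: "open ?H" by (simp add: open_halfspace_Re_lt)
  define s0 where "s0 = complex_of_real (- B - 1)"
  have s0: "s0 \<in> ?H" by (simp add: s0_def)
  have "0 \<in> ?S" using z unfolding p by auto
  then have "L 0 - R 0 = 0"
    using analytic_continuation_open[OF Hopen op _ conn HS hol holomorphic_on_const[of 0]] s0 zero by blast
  moreover have "\<zeta> 0 = z" by (simp add: \<zeta>_def vec_eq_iff)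
  ultimately show ?thesis by (simp add: L_def R_def)
qed

end

section \<open>Barnes polynomials and the lattice point count\<close>

text \<open>Convergence at one nonzero point gives a positive radius. The closed form is claimed
  only near 0 and not at 0, where the quotient has the default value of a division by zero.\<close>

lemma barnes_fps_expansion:
  fixes a :: "complex ^ 'n"
  assumes "\<And>j. a $ j \<noteq> 0"
  shows "eval_fps (barnes_fps t a) has_fps_expansion barnes_fps t a"
    "eventually (\<lambda>x. eval_fps (barnes_fps t a) x = x ^ CARD('n) * exp (t * x) / (\<Prod>j\<in>UNIV. exp (a $ j * x) - 1)) (at 0)"
proof -
  let ?F = "barnes_fps t a"
  let ?f = "\<lambda>x. x ^ CARD('n) * exp (t * x) / (\<Prod>j\<in>UNIV. exp (a $ j * x) - 1)"
  have "eventually (\<lambda>x. (\<lambda>k. barnes_poly k t a * x ^ k / fact k) sums ?f x) (at 0)"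
    by (rule barnes_poly_sums[OF assms])
  then have s: "eventually (\<lambda>x. (\<lambda>k. fps_nth ?F k * x ^ k) sums ?f x) (at 0)"
    by (simp add: barnes_poly_def)
  have "eventually (\<lambda>x::complex. x \<noteq> 0) (at 0)" by (simp add: eventually_at_filter)
  with s have "\<exists>\<^sub>F x in at 0. (\<lambda>k. fps_nth ?F k * x ^ k) sums ?f x \<and> x \<noteq> 0"
    by (intro eventually_frequently eventually_conj) auto
  then obtain x where x: "(\<lambda>k. fps_nth ?F k * x ^ k) sums ?f x" "x \<noteq> 0"
    by (auto dest: frequently_ex)
  have "fps_conv_radius ?F \<ge> norm x"
    unfolding fps_conv_radius_def by (rule conv_radius_geI) (use x in \<open>auto simp: sums_iff\<close>)
  then have "fps_conv_radius ?F > 0"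
    using x(2) by (metis ereal_less(2) less_le_trans zero_less_norm_iff)
  then show "eval_fps ?F has_fps_expansion ?F" by (simp add: has_fps_expansion_def)
  show "eventually (\<lambda>x. eval_fps ?F x = ?f x) (at 0)"
    using s by eventually_elim (simp add: eval_fps_def sums_iff)
qed

text \<open>The denominator has subdegree d, so it divides \<open>fps_X ^ CARD('n)\<close> exactly
  and the exponential can be pulled out of the quotient.\<close>

lemma barnes_fps_shift:
  fixes a :: "complex ^ 'n"
  assumes "\<And>j. a $ j \<noteq> 0"
  shows "barnes_fps t a = fps_exp t * barnes_fps 0 a"
proof -
  let ?G = "\<Prod>j\<in>UNIV. fps_exp (a $ j) - 1"
  have sub1: "subdegree (fps_exp (a $ j) - 1) = 1" for j
    by (rule subdegreeI) (use assms[of j] in auto)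
  have nz1: "fps_exp (a $ j) - 1 \<noteq> 0" for j
    using sub1[of j] by (metis subdegree_0 zero_neq_one)
  have G: "?G \<noteq> 0" using nz1 by simp
  have "subdegree ?G = CARD('n)"
    by (subst subdegree_prod) (simp_all only: nz1 sub1 sum_constant of_nat_id mult_1_right not_False_eq_True)
  then have dvd: "?G dvd fps_X ^ CARD('n)"
    using G by (subst fps_dvd_iff) auto
  show ?thesis
    unfolding barnes_fps_def using div_mult_swap[OF dvd, of "fps_exp t"] by (simp add: mult.commute)
qed

lemma barnes_poly_shift:
  fixes a :: "complex ^ 'n"
  assumes "\<And>j. a $ j \<noteq> 0"
  shows "barnes_poly k t a = (\<Sum>r\<le>k. of_nat (k choose r) * t ^ r * barnes_number (k - r) a)"
proof -
  have "barnes_poly k t a = (\<Sum>r\<le>k. fact k * (t ^ r / fact r * fps_nth (barnes_fps 0 a) (k - r)))"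
    by (simp add: barnes_poly_def barnes_fps_shift[OF assms, of t] fps_mult_nth sum_distrib_left atLeast0AtMost)
  also have "\<dots> = (\<Sum>r\<le>k. of_nat (k choose r) * t ^ r * barnes_number (k - r) a)"
    by (intro sum.cong refl) (simp add: barnes_number_def barnes_poly_def binomial_fact)
  finally show ?thesis .
qed

text \<open>Within radius pi / |a| the product a x stays in a disk on which exp is injective. This
  makes Brion's formula available at x z.\<close>

lemma eventually_exp_neq_1:
  fixes a :: complex
  assumes "a \<noteq> 0"
  shows "eventually (\<lambda>x. exp (a * x) \<noteq> 1) (at 0)"
proof -
  have "exp (a * x) \<noteq> 1" if x: "x \<noteq> 0" "dist x 0 < pi / norm a" for x
  proof
    assume "exp (a * x) = 1"
    then have eq: "exp (a * x) = exp 0" by simp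
    have "norm (a * x) < pi" using x assms by (simp add: norm_mult field_simps)
    then have "a * x \<in> ball 0 pi" by simp
    then have "a * x = 0" by (rule inj_onD[OF inj_on_exp_pi[of 0] eq]) simp
    then show False using x assms by simp
  qed
  moreover have "pi / norm a > 0" using assms by simp
  ultimately show ?thesis unfolding eventually_at by blast
qed

text \<open>With j = k - r the product of binomials (d choose k) (k choose r) is the trinomial
  coefficient, and the double sum runs over the triangle r + j \<le> d.\<close>

lemma trinomial_expansion:
  fixes S B :: "nat \<Rightarrow> complex"
  shows "(\<Sum>k\<le>d. of_nat (d choose k) * (\<Sum>r\<le>k. of_nat (k choose r) * u ^ r * B (k - r)) * S (d - k))
    = (\<Sum>r\<le>d. u ^ r * (\<Sum>j\<le>d - r. trinomial d r j * B j * S (d - r - j)))"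
proof -
  let ?g = "\<lambda>r j. u ^ r * (trinomial d r j * B j * S (d - r - j))"
  have "(\<Sum>k\<le>d. of_nat (d choose k) * (\<Sum>r\<le>k. of_nat (k choose r) * u ^ r * B (k - r)) * S (d - k))
      = (\<Sum>k\<le>d. \<Sum>r\<le>k. ?g r (k - r))"
  proof (rule sum.cong[OF refl])
    fix k assume k: "k \<in> {..d}"
    have tri: "of_nat (d choose k) * of_nat (k choose r) = trinomial d r (k - r)" if "r \<le> k" for r
      using that k by (simp add: trinomial_def binomial_fact field_simps)
    show "of_nat (d choose k) * (\<Sum>r\<le>k. of_nat (k choose r) * u ^ r * B (k - r)) * S (d - k)
      = (\<Sum>r\<le>k. ?g r (k - r))"
      unfolding sum_distrib_left sum_distrib_right
      by (intro sum.cong refl) (simp add: tri[symmetric] mult_ac)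
  qed
  also have "\<dots> = (\<Sum>(r, j)\<in>{(r, j). r + j \<le> d}. ?g r j)"
    by (rule sum.triangle_reindex_eq[symmetric])
  also have "{(r, j). r + j \<le> d} = (SIGMA r:{..d}. {..d - r})" by auto
  also have "(\<Sum>(r, j)\<in>(SIGMA r:{..d}. {..d - r}). ?g r j) = (\<Sum>r\<le>d. \<Sum>j\<le>d - r. ?g r j)"
    by (rule sum.Sigma[symmetric]) auto
  finally show ?thesis by (simp add: sum_distrib_left)
qed

section \<open>Periodicity and uniqueness of quasi-coefficients\<close>

lemma pped_points_translate:
  assumes "u \<in> int_lattice"
  shows "pped_points b (y + u) = pped_points b y"
proof -
  have "(\<lambda>q. q - (y + u)) ` int_lattice = (\<lambda>q. q - y) ` int_lattice"
  proof (intro set_eqI iffI)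
    fix x assume "x \<in> (\<lambda>q. q - (y + u)) ` int_lattice"
    then obtain q where q: "q \<in> int_lattice" "x = q - (y + u)" by blast
    have "q - u \<in> int_lattice" using q assms by (simp add: int_lattice_def)
    moreover have "x = (q - u) - y" using q by simp
    ultimately show "x \<in> (\<lambda>q. q - y) ` int_lattice" by blast
  next
    fix x assume "x \<in> (\<lambda>q. q - y) ` int_lattice"
    then obtain q where q: "q \<in> int_lattice" "x = q - y" by blast
    have "q + u \<in> int_lattice" using q assms by (simp add: int_lattice_def)
    moreover have "x = (q + u) - (y + u)" using q by simp
    ultimately show "x \<in> (\<lambda>q. q - (y + u)) ` int_lattice" by blast
  qed
  then show ?thesis by (simp add: pped_points_def)
qed

text \<open>Along t, t + Q, t + 2 Q and so on periodicity freezes the coefficients, so one fixed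
  polynomial has infinitely many roots.\<close>

lemma periodic_coeffs_unique:
  fixes c :: "nat \<Rightarrow> real \<Rightarrow> complex"
  assumes Q: "Q > 0" and per: "\<And>r t. r \<le> d \<Longrightarrow> t > 0 \<Longrightarrow> c r (t + Q) = c r t"
    and zero: "\<And>t. t > 0 \<Longrightarrow> (\<Sum>r\<le>d. c r t * of_real t ^ r) = 0"
    and t: "t > 0" and r: "r \<le> d"
  shows "c r t = 0"
proof (rule ccontr)
  assume "c r t \<noteq> 0"
  then have fin: "finite {x. (\<Sum>r\<le>d. c r t * x ^ r) = 0}"
    using r by (subst polyfun_finite_roots) blast
  have pern: "c r (t + real n * Q) = c r t" if "r \<le> d" for r n
  proof (induction n)
    case (Suc n)
    have "t + real n * Q > 0" using t Q by (simp add: add_pos_nonneg)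
    then show ?case using per[OF that, of "t + real n * Q"] Suc by (simp add: algebra_simps)
  qed simp
  have "(\<Sum>r\<le>d. c r t * of_real (t + real n * Q) ^ r) = 0" for n
  proof -
    have "t + real n * Q > 0" using t Q by (simp add: add_pos_nonneg)
    from zero[OF this] show ?thesis using pern by simp
  qed
  then have "range (\<lambda>n. complex_of_real (t + real n * Q)) \<subseteq> {x. (\<Sum>r\<le>d. c r t * x ^ r) = 0}"
    by blast
  moreover have "inj (\<lambda>n. complex_of_real (t + real n * Q))"
    using Q by (auto simp: inj_def)
  ultimately show False using fin by (meson finite_subset range_inj_infinite)
qed

context rational_simple_polytope
begin

lemma generic_edge_pairings:
  assumes "generic P w z" "v \<in> vertices P"
  shows "edge_pairings (w v) z $ k \<noteq> 0"
  using assms(1)[unfolded generic_def, rule_format, OF assms(2), of k 0]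
  by (simp add: edge_pairings_def)

lemma lattice_count_barnes:
  assumes z: "generic P w z" and t: "t > 0"
  shows "of_nat (lattice_count P t) =
        (-1) ^ CARD('n) / fact CARD('n) *
        (\<Sum>v\<in>vertices P. \<Sum>k\<le>CARD('n).
           of_nat (CARD('n) choose k) *
           barnes_poly k (complex_of_real t * pairing v z) (edge_pairings (w v) z) *
           (\<Sum>p\<in>pped_points (w v) (t *\<^sub>R v). pairing p z ^ (CARD('n) - k)))"
proof -
  let ?d = "CARD('n)"
  let ?T = "(*\<^sub>R) t ` P \<inter> int_lattice"
  let ?a = "\<lambda>v. edge_pairings (w v) z"
  let ?u = "\<lambda>v. complex_of_real t * pairing v z"
  let ?S = "\<lambda>v. pped_points (w v) (t *\<^sub>R v)"
  define B where "B v = eval_fps (barnes_fps (?u v) (?a v))" for v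
  have B: "B v has_fps_expansion (barnes_fps (?u v) (?a v))"
    "eventually (\<lambda>x. B v x = x ^ ?d * exp (?u v * x) / (\<Prod>j\<in>UNIV. exp (?a v $ j * x) - 1)) (at 0)"
    if "v \<in> vertices P" for v
    unfolding B_def by (rule barnes_fps_expansion[OF generic_edge_pairings[OF z that]])+
  define l where "l x = x ^ ?d * (\<Sum>q\<in>?T. exp (pairing q z * x))" for x
  define r where "r x = (\<Sum>v\<in>vertices P. B v x * (\<Sum>p\<in>?S v. (-1) ^ ?d * exp (pairing p z * x)))" for x
  define FL where "FL = fps_X ^ ?d * (\<Sum>q\<in>?T. fps_exp (pairing q z))"
  define FR where "FR = (\<Sum>v\<in>vertices P. barnes_fps (?u v) (?a v) *
    (\<Sum>p\<in>?S v. fps_const ((-1) ^ ?d) * fps_exp (pairing p z)))"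
  have FL: "l has_fps_expansion FL"
    unfolding l_def FL_def by (intro fps_expansion_intros)
  have FR: "r has_fps_expansion FR"
    unfolding r_def FR_def by (intro fps_expansion_intros B)
  have "eventually (\<lambda>x. \<forall>v\<in>vertices P.
      B v x = x ^ ?d * exp (?u v * x) / (\<Prod>j\<in>UNIV. exp (?a v $ j * x) - 1)) (at 0)"
    using finite_vertices B(2) by (intro eventually_ball_finite) auto
  moreover have "eventually (\<lambda>x. \<forall>v\<in>vertices P. \<forall>k. exp (?a v $ k * x) \<noteq> 1) (at 0)"
    using finite_vertices generic_edge_pairings[OF z]
    by (intro eventually_ball_finite eventually_all_finite ballI eventually_exp_neq_1)
  ultimately have "eventually (\<lambda>x. l x = r x) (at 0)"
  proof eventually_elim
    case (elim x)
    define zx where "zx = (\<chi> m. x * z $ m)"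
    have px: "pairing y zx = pairing y z * x" for y
      unfolding zx_def pairing_scale_right by simp
    have "exp (pairing (w v k) zx) \<noteq> 1" if "v \<in> vertices P" for v k
      using elim(2) that unfolding px by (auto simp: edge_pairings_def)
    then have "(\<Sum>q\<in>?T. exp (pairing q zx)) = (\<Sum>v\<in>vertices P. brion_term t v zx)"
      by (rule Brion[OF t])
    then have "l x = (\<Sum>v\<in>vertices P. x ^ ?d * brion_term t v zx)"
      unfolding l_def px by (simp add: sum_distrib_left)
    also have "\<dots> = r x"
      unfolding r_def
    proof (rule sum.cong[OF refl])
      fix v assume v: "v \<in> vertices P"
      \<comment> \<open>Brion's factors are 1 - exp, the Barnes factors exp - 1; this is the origin
        of the sign (-1)^d.\<close>
      have neg: "(\<Prod>k\<in>UNIV. 1 - exp (pairing (w v k) z * x))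
          = (-1) ^ ?d * (\<Prod>k\<in>UNIV. exp (?a v $ k * x) - 1)"
      proof -
        have "(\<Prod>k\<in>UNIV. 1 - exp (pairing (w v k) z * x))
          = (\<Prod>k\<in>(UNIV::'n set). (-1) * (exp (?a v $ k * x) - 1))"
          by (simp add: edge_pairings_def)
        then show ?thesis by (simp only: prod.distrib prod_constant)
      qed
      have "(-1) ^ ?d * ((-1) ^ ?d :: complex) = 1" by (simp flip: power_mult_distrib)
      then have inv: "inverse ((-1) ^ ?d) = ((-1) ^ ?d :: complex)" by (rule inverse_unique)
      have "B v x = x ^ ?d * exp (?u v * x) / (\<Prod>j\<in>UNIV. exp (?a v $ j * x) - 1)"
        using elim(1) v by blast
      then show "x ^ ?d * brion_term t v zx = B v x * (\<Sum>p\<in>?S v. (-1) ^ ?d * exp (pairing p z * x))"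
        unfolding brion_term_def px neg
        by (simp add: divide_inverse inverse_mult_distrib inv sum_distrib_left[symmetric] mult_ac)
    qed
    finally show ?case .
  qed
  \<comment> \<open>Brion's formula gives equality only off 0, and a Laurent expansion does not see
    the value at 0.\<close>
  then have "l has_laurent_expansion fps_to_fls FL \<longleftrightarrow> r has_laurent_expansion fps_to_fls FL"
    by (rule has_laurent_expansion_cong) simp
  then have "FL = FR"
    using has_laurent_expansion_fps[OF FL] has_laurent_expansion_fps[OF FR]
      has_laurent_expansion_unique fps_to_fls_eq_iff by blast
  then have "fps_nth FL ?d = fps_nth FR ?d" by simp
  \<comment> \<open>The power of \<open>fps_X\<close> moves the constant coefficients to degree d,
    where each lattice point counts 1.\<close>
  moreover have "fps_nth FL ?d = of_nat (lattice_count P t)"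
    by (simp add: FL_def fps_X_power_mult_nth fps_sum_nth lattice_count_def)
  moreover have "fps_nth FR ?d = (-1) ^ ?d / fact ?d *
        (\<Sum>v\<in>vertices P. \<Sum>k\<le>?d. of_nat (?d choose k) * barnes_poly k (?u v) (?a v) *
           (\<Sum>p\<in>?S v. pairing p z ^ (?d - k)))"
    unfolding FR_def fps_sum_nth fps_mult_nth[of "barnes_fps _ _"] sum_distrib_left[of _ _ "vertices P"]
      sum_distrib_left[of _ _ "{..?d}"] atLeast0AtMost
  proof (intro sum.cong refl)
    fix v k assume "k \<in> {..?d}"
    then have bin: "of_nat (?d choose k) = (fact ?d / (fact k * fact (?d - k)) :: complex)"
      by (simp add: binomial_fact)
    show "fps_nth (barnes_fps (?u v) (?a v)) k *
        (\<Sum>p\<in>?S v. fps_nth (fps_const ((-1) ^ ?d) * fps_exp (pairing p z)) (?d - k)) =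
      (-1) ^ ?d / fact ?d * (of_nat (?d choose k) * barnes_poly k (?u v) (?a v) *
        (\<Sum>p\<in>?S v. pairing p z ^ (?d - k)))"
      unfolding bin barnes_poly_def
      by (simp add: sum_distrib_left[symmetric] sum_divide_distrib[symmetric] field_simps)
  qed
  ultimately show ?thesis by simp
qed

text \<open>Complex and dependent on z by its form; that it is real and the same for all generic z,
  when t > 0 and r is at most d, comes out of \<open>quasi_coeffs_eq\<close>.\<close>

definition barnes_coeff :: "complex ^ 'n \<Rightarrow> nat \<Rightarrow> real \<Rightarrow> complex" where
  "barnes_coeff z r t = (-1) ^ CARD('n) / fact CARD('n) *
        (\<Sum>v\<in>vertices P. pairing v z ^ r *
          (\<Sum>j\<le>CARD('n) - r.
             trinomial CARD('n) r j * barnes_number j (edge_pairings (w v) z) *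
             (\<Sum>p\<in>pped_points (w v) (t *\<^sub>R v). pairing p z ^ (CARD('n) - r - j))))"

lemma lattice_count_barnes_coeff:
  assumes z: "generic P w z" and t: "t > 0"
  shows "of_nat (lattice_count P t) = (\<Sum>r\<le>CARD('n). barnes_coeff z r t * of_real t ^ r)"
proof -
  let ?d = "CARD('n)"
  let ?a = "\<lambda>v. edge_pairings (w v) z"
  let ?S = "\<lambda>v m. \<Sum>p\<in>pped_points (w v) (t *\<^sub>R v). pairing p z ^ m"
  let ?J = "\<lambda>v r. \<Sum>j\<le>?d - r. trinomial ?d r j * barnes_number j (?a v) * ?S v (?d - r - j)"
  have "of_nat (lattice_count P t) = (-1) ^ ?d / fact ?d *
    (\<Sum>v\<in>vertices P. \<Sum>k\<le>?d. of_nat (?d choose k) *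
      barnes_poly k (complex_of_real t * pairing v z) (?a v) * ?S v (?d - k))"
    by (rule lattice_count_barnes[OF z t])
  also have "(\<Sum>v\<in>vertices P. \<Sum>k\<le>?d. of_nat (?d choose k) *
      barnes_poly k (complex_of_real t * pairing v z) (?a v) * ?S v (?d - k))
    = (\<Sum>v\<in>vertices P. \<Sum>r\<le>?d. (complex_of_real t * pairing v z) ^ r * ?J v r)"
  proof (rule sum.cong[OF refl])
    fix v assume v: "v \<in> vertices P"
    show "(\<Sum>k\<le>?d. of_nat (?d choose k) *
      barnes_poly k (complex_of_real t * pairing v z) (?a v) * ?S v (?d - k))
      = (\<Sum>r\<le>?d. (complex_of_real t * pairing v z) ^ r * ?J v r)"
      unfolding barnes_poly_shift[OF generic_edge_pairings[OF z v]]
      by (rule trinomial_expansion)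
  qed
  also have "\<dots> = (\<Sum>r\<le>?d. \<Sum>v\<in>vertices P. (complex_of_real t * pairing v z) ^ r * ?J v r)"
    by (rule sum.swap)
  finally show ?thesis
    by (simp add: barnes_coeff_def sum_distrib_left sum_distrib_right power_mult_distrib mult_ac)
qed

text \<open>t enters only through the points of the parallelepipeds. If Q clears the denominators of
  all vertices, passing to t + Q translates each lattice by the integer vector Q v.\<close>

lemma barnes_coeff_periodic:
  obtains Q :: nat where "Q > 0" "\<And>z r t. barnes_coeff z r (t + real Q) = barnes_coeff z r t"
proof -
  let ?A = "(\<lambda>(v, i). v $ i) ` (vertices P \<times> UNIV)"
  have "?A \<subseteq> \<rat>" using rational by (auto simp: rational_polytope_def)
  moreover have "finite ?A" using finite_vertices by simp
  ultimately obtain Q :: nat where Q: "Q > 0" "\<forall>x\<in>?A. real Q * x \<in> \<int>"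
    using common_denominator by blast
  have "real Q *\<^sub>R v \<in> int_lattice" if "v \<in> vertices P" for v
    using Q(2) that by (auto simp: int_lattice_def)
  then have "pped_points (w v) ((t + real Q) *\<^sub>R v) = pped_points (w v) (t *\<^sub>R v)"
    if "v \<in> vertices P" for v t
    using that by (simp add: scaleR_add_left pped_points_translate)
  then have "barnes_coeff z r (t + real Q) = barnes_coeff z r t" for z r t
    by (simp add: barnes_coeff_def)
  then show ?thesis using that Q(1) by blast
qed

text \<open>A generic real direction serves: its pairings are nonzero reals, while multiples of 2 pi
  i are imaginary.\<close>

lemma ex_generic: "\<exists>z. generic P w z"
proof -
  obtain \<xi> where \<xi>: "generic_dir \<xi>" using generic_dir_dense[of 1 0] by auto
  have p: "pairing x (\<chi> i. complex_of_real (\<xi> $ i)) = of_real (x \<bullet> \<xi>)" for x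
    by (simp add: pairing_def inner_vec_def)
  have "generic P w (\<chi> i. complex_of_real (\<xi> $ i))"
    using \<xi> unfolding generic_def generic_dir_def p by (auto simp: complex_eq_iff)
  then show ?thesis ..
qed

text \<open>The count and the powers of t are real, so real parts of \<open>barnes_coeff\<close> at
  one generic z suffice.\<close>

lemma ex_quasi_coeffs: "\<exists>c. ehrhart_quasi_coeffs P c"
proof -
  obtain z where z: "generic P w z" using ex_generic by blast
  obtain Q :: nat where Q: "Q > 0" "\<And>z r t. barnes_coeff z r (t + real Q) = barnes_coeff z r t"
    using barnes_coeff_periodic by blast
  have "real (lattice_count P t) = (\<Sum>r\<le>CARD('n). Re (barnes_coeff z r t) * t ^ r)" if "t > 0" for t
  proof -
    have "real (lattice_count P t) = Re (of_nat (lattice_count P t))" by simp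
    also have "\<dots> = (\<Sum>r\<le>CARD('n). Re (barnes_coeff z r t * of_real (t ^ r)))"
      by (simp add: lattice_count_barnes_coeff[OF z that])
    finally show ?thesis by (simp del: of_real_power)
  qed
  then have "ehrhart_quasi_coeffs P (\<lambda>r t. Re (barnes_coeff z r t))"
    unfolding ehrhart_quasi_coeffs_def using Q by auto
  then show ?thesis by blast
qed

text \<open>The given coefficients come with their own period q, so the difference is compared along
  the common period Q q.\<close>

lemma quasi_coeffs_eq:
  assumes c: "ehrhart_quasi_coeffs P c" and z: "generic P w z" and t: "t > 0" and r: "r \<le> CARD('n)"
  shows "complex_of_real (c r t) = barnes_coeff z r t"
proof -
  obtain q :: nat where q: "q > 0" "\<And>r t. r \<le> CARD('n) \<Longrightarrow> t > 0 \<Longrightarrow> c r (t + real q) = c r t"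
    and cnt: "\<And>t. t > 0 \<Longrightarrow> real (lattice_count P t) = (\<Sum>r\<le>CARD('n). c r t * t ^ r)"
    using c unfolding ehrhart_quasi_coeffs_def by blast
  obtain Q :: nat where Q: "Q > 0" "\<And>z r t. barnes_coeff z r (t + real Q) = barnes_coeff z r t"
    using barnes_coeff_periodic by blast
  have qn: "c r (t + real (n * q)) = c r t" if "r \<le> CARD('n)" "t > 0" for r t n
  proof (induction n)
    case (Suc n)
    have "t + real (n * q) > 0" using that by (simp add: add_pos_nonneg)
    then show ?case using q(2)[OF that(1), of "t + real (n * q)"] Suc by (simp add: algebra_simps)
  qed simp
  have Qn: "barnes_coeff z r (t + real (n * Q)) = barnes_coeff z r t" for r t n
  proof (induction n)
    case (Suc n)
    then show ?case using Q(2)[of z r "t + real (n * Q)"] by (simp add: algebra_simps)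
  qed simp
  let ?e = "\<lambda>r t. complex_of_real (c r t) - barnes_coeff z r t"
  have "?e r t = 0"
  proof (rule periodic_coeffs_unique[of "real (Q * q)" "CARD('n)" ?e])
    show "real (Q * q) > 0" using q Q by simp
    show "?e r (t + real (Q * q)) = ?e r t" if "r \<le> CARD('n)" "t > 0" for r t
      using qn[OF that, of Q] Qn[of r t q] by (simp add: mult.commute)
    fix t :: real assume t: "t > 0"
    have "complex_of_real (real (lattice_count P t)) = (\<Sum>r\<le>CARD('n). of_real (c r t) * of_real t ^ r)"
      unfolding cnt[OF t] by simp
    then show "(\<Sum>r\<le>CARD('n). ?e r t * of_real t ^ r) = 0"
      using lattice_count_barnes_coeff[OF z t] by (simp add: left_diff_distrib sum_subtractf)
  qed (use t r in auto)
  then show ?thesis by simp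
qed

end

theorem theorem1:
  fixes P :: "(real ^ 'n) set" and w :: "real ^ 'n \<Rightarrow> 'n \<Rightarrow> real ^ 'n"
  assumes "rational_polytope P"
    and "simple_polytope P"
    and "aff_dim P = int CARD('n)"
    and "\<And>v. v \<in> vertices P \<Longrightarrow> bij_betw (w v) UNIV (primitive_edge_vectors P v)"
  shows "(\<forall>z. generic P w z \<longrightarrow> (\<forall>t>0.
      of_nat (lattice_count P t) =
        (-1) ^ CARD('n) / fact CARD('n) *
        (\<Sum>v\<in>vertices P. \<Sum>k\<le>CARD('n).
           of_nat (CARD('n) choose k) *
           barnes_poly k (complex_of_real t * pairing v z) (edge_pairings (w v) z) *
           (\<Sum>p\<in>pped_points (w v) (t *\<^sub>R v). pairing p z ^ (CARD('n) - k)))))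
    \<and> (\<exists>c. ehrhart_quasi_coeffs P c)
    \<and> (\<forall>c. ehrhart_quasi_coeffs P c \<longrightarrow> (\<forall>z. generic P w z \<longrightarrow> (\<forall>t>0. \<forall>r\<le>CARD('n).
      complex_of_real (c r t) =
        (-1) ^ CARD('n) / fact CARD('n) *
        (\<Sum>v\<in>vertices P. pairing v z ^ r *
          (\<Sum>j\<le>CARD('n) - r.
             trinomial CARD('n) r j * barnes_number j (edge_pairings (w v) z) *
             (\<Sum>p\<in>pped_points (w v) (t *\<^sub>R v). pairing p z ^ (CARD('n) - r - j)))))))"
proof -
  interpret rational_simple_polytope P w
    by unfold_locales (use assms in auto)
  show ?thesis
    using lattice_count_barnes ex_quasi_coeffs quasi_coeffs_eq unfolding barnes_coeff_def by blast
qed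

end
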